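(* Let $(K,k)$ be a club such that - the functor $k:K\to B\Sigma$ is bijective on objects, and - $K$ is a groupoid. Then $(K,k)\cong(B\Lambda,B\pi)$, as clubs, for some action operad $(\Lambda,\pi)$. The assignment $\Lambda\mapsto(B\Lambda,B\pi)$ is a full and faithful embedding of the category of action operads $\mathbf{AOp}$ into the category of clubs.
   Context: $\mathbb N\ni 0$; $e_n$ is the identity of $\Lambda(n)$; permutations compose as functions. A (non-symmetric) operad $O$ in sets: sets $O(n)$ ($n\in\mathbb N$), $\mathrm{id}\in O(1)$, functions $\mu:O(n)\times O(k_1)\times\cdots\times O(k_n)\to O(k_1+\cdots+k_n)$, unital and associative in the usual sense; maps preserve $\mathrm{id}$ and $\mu$. The operad $\Sigma$ of symmetric groups has $\mu^\Sigma(\sigma;\tau_1,\dots,\tau_n)=\delta(\sigma)\cdot\beta(\tau_1,\dots,\tau_n)$, with $\beta$ the block sum of the permutations $\tau_i\in\Sigma_{k_i}$ and $\delta(\sigma)=\delta_{n;k_1,\dots,k_n}(\sigma)$ sending $k_1+\cdots+k_{i-1}+a$ ($1\le a\le k_i$) to $(\sum_{\sigma(i')<\sigma(i)}k_{i'})+a$. An action operad $(\Lambda,\pi)$: an operad $\Lambda$ in sets with a group structure on each $\Lambda(n)$ and a map of operads $\pi:\Lambda\to\Sigma$ whose components are group homomorphisms, such that, writing $g(i)=\pi_n(g)(i)$, $\mu(g';f_1',\dots,f_n')\mu(g;f_1,\dots,f_n)=\mu(g'g;f'_{g(1)}f_1,\dots,f'_{g(n)}f_n)$ for $g,g'\in\Lambda(n)$,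 $f_i\in\Lambda(k_i)$, $f_i'\in\Lambda(k_{g^{-1}(i)})$. Morphisms of $\mathbf{AOp}$ are maps of operads $f:\Lambda\to\Lambda'$ with $\pi^{\Lambda'}f=\pi^\Lambda$ and each $f_n$ a group homomorphism. $B\Lambda$ is the groupoid with objects the natural numbers, $B\Lambda(n,n)=\Lambda(n)$ with composition the group multiplication, and no morphisms $m\to n$ for $m\ne n$; similarly $B\Sigma$, and $B\pi$ is the identity on objects and $\pi_n$ on morphisms. A club is a monoid in the monoidal category $\mathbf{Cat}/B\Sigma$ of collections for the cartesian 2-monad $T=\underline{E\Sigma}$ (the free symmetric strict monoidal category 2-monad), where $T1=B\Sigma$ and $X\circ Y$ is the pullback of $X\to T1\leftarrow TY$ equipped with the composite $X\circ Y\to TY\to T^21\to T1$; morphisms of clubs are monoid morphisms. Explicitly, a club is a category $K$ with a functor $k:K\to B\Sigma$, a functor $m:K\circ K\to K$ over $B\Sigma$ and an object $u\in K$ with $k(u)=1$, satisfying strict associativity and unit laws. Here $K\circ K$ has objects $(x;y_1,\dots,y_n)$ with $k(x)=n$; a morphism $(x;y_1,\dots,y_n)\to(z;w_1,\dots,w_n)$ consists of $f:x\to z$ and $g_i:y_i\to w_{k(f)(i)}$ in $K$; composition is $(f';g'_1,\dots,g'_n)\circ(f;g_1,\dots,g_n)=(f'f;g'_{k(f)(1)}g_1,\dots,g'_{k(f)(n)}g_n)$; and $K\circ K\to B\Sigma$ sends $(x;y_1,\dots,y_n)$ to $\sum_ik(y_i)$ and $(f;g_1,\dots,g_n)$ to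 $\mu^\Sigma(k(f);k(g_1),\dots,k(g_n))$. A morphism of clubs is a functor over $B\Sigma$ preserving $m$ and $u$. The club structure on $(B\Lambda,B\pi)$ is $m(n;k_1,\dots,k_n)=\sum k_i$, $m(f;g_1,\dots,g_n)=\mu(f;g_1,\dots,g_n)$, $u=1$. *)

theory Defs
  imports "HOL-Algebra.Sym_Groups"
begin

text \<open>
  Structures are records, and every structure map is extensional (it lies in a function set
  \<open>A \<rightarrow>\<^sub>E B\<close>, so it is undefined outside its domain). Hence equality of records is
  equality of the mathematical structures; this matters for the categories of action operads and
  of clubs, whose objects and arrows are such records, and for injectivity on objects.
\<close>

section \<open>Categories\<close>

text \<open>\<open>Comp C (g, f)\<close> is the composite of \<open>g\<close> after \<open>f\<close>.\<close>

record ('o, 'm) cat =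
  Obj :: "'o set"
  Arr :: "'m set"
  Dom :: "'m \<Rightarrow> 'o"
  Cod :: "'m \<Rightarrow> 'o"
  Ident :: "'o \<Rightarrow> 'm"
  Comp :: "'m \<times> 'm \<Rightarrow> 'm"

definition composable :: "('o, 'm) cat \<Rightarrow> ('m \<times> 'm) set" where
  "composable C = {(g, f). g \<in> Arr C \<and> f \<in> Arr C \<and> Dom C g = Cod C f}"

definition Hom :: "('o, 'm) cat \<Rightarrow> 'o \<Rightarrow> 'o \<Rightarrow> 'm set" where
  "Hom C x y = {f \<in> Arr C. Dom C f = x \<and> Cod C f = y}"

locale category =
  fixes C :: "('o, 'm) cat"
  assumes Dom_type: "Dom C \<in> Arr C \<rightarrow>\<^sub>E Obj C"
    and Cod_type: "Cod C \<in> Arr C \<rightarrow>\<^sub>E Obj C"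
    and Ident_type: "Ident C \<in> Obj C \<rightarrow>\<^sub>E Arr C"
    and Comp_type: "Comp C \<in> composable C \<rightarrow>\<^sub>E Arr C"
    and Ident_Hom: "x \<in> Obj C \<Longrightarrow> Ident C x \<in> Hom C x x"
    and Comp_Hom: "(g, f) \<in> composable C \<Longrightarrow> Comp C (g, f) \<in> Hom C (Dom C f) (Cod C g)"
    and Ident_left: "f \<in> Arr C \<Longrightarrow> Comp C (Ident C (Cod C f), f) = f"
    and Ident_right: "f \<in> Arr C \<Longrightarrow> Comp C (f, Ident C (Dom C f)) = f"
    and Comp_assoc: "(h, g) \<in> composable C \<Longrightarrow> (g, f) \<in> composable C \<Longrightarrow>
      Comp C (Comp C (h, g), f) = Comp C (h, Comp C (g, f))"

locale groupoid = category +
  assumes inverses: "f \<in> Arr C \<Longrightarrow> \<exists>g \<in> Hom C (Cod C f) (Dom C f).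
      Comp C (g, f) = Ident C (Dom C f) \<and> Comp C (f, g) = Ident C (Cod C f)"

record ('o, 'm, 'p, 'q) funct =
  omap :: "'o \<Rightarrow> 'p"
  amap :: "'m \<Rightarrow> 'q"

locale is_functor = source: category C + target: category D
  for C :: "('o, 'm) cat" and D :: "('p, 'q) cat" +
  fixes F :: "('o, 'm, 'p, 'q) funct"
  assumes omap_type: "omap F \<in> Obj C \<rightarrow>\<^sub>E Obj D"
    and amap_type: "amap F \<in> Arr C \<rightarrow>\<^sub>E Arr D"
    and amap_Hom: "f \<in> Arr C \<Longrightarrow> amap F f \<in> Hom D (omap F (Dom C f)) (omap F (Cod C f))"
    and amap_Ident: "x \<in> Obj C \<Longrightarrow> amap F (Ident C x) = Ident D (omap F x)"
    and amap_Comp: "(g, f) \<in> composable C \<Longrightarrow>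
      amap F (Comp C (g, f)) = Comp D (amap F g, amap F f)"

definition id_funct :: "('o, 'm) cat \<Rightarrow> ('o, 'm, 'o, 'm) funct" where
  "id_funct C = \<lparr>omap = (\<lambda>x\<in>Obj C. x), amap = (\<lambda>f\<in>Arr C. f)\<rparr>"

definition comp_funct :: "('o, 'm) cat \<Rightarrow> ('p, 'q, 'r, 's) funct \<Rightarrow> ('o, 'm, 'p, 'q) funct
    \<Rightarrow> ('o, 'm, 'r, 's) funct" where
  "comp_funct C G F =
    \<lparr>omap = compose (Obj C) (omap G) (omap F), amap = compose (Arr C) (amap G) (amap F)\<rparr>"

locale full_faithful_embedding = is_functor C D F
  for C :: "('o, 'm) cat" and D :: "('p, 'q) cat" and F :: "('o, 'm, 'p, 'q) funct" +
  assumes full: "x \<in> Obj C \<Longrightarrow> y \<in> Obj C \<Longrightarrow> h \<in> Hom D (omap F x) (omap F y) \<Longrightarrow>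
      \<exists>f \<in> Hom C x y. amap F f = h"
    and faithful: "x \<in> Obj C \<Longrightarrow> y \<in> Obj C \<Longrightarrow> inj_on (amap F) (Hom C x y)"
    and embedding: "inj_on (omap F) (Obj C)"

section \<open>Operads\<close>

text \<open>
  The sets \<open>ops P n\<close> for different \<open>n\<close> need not be disjoint, so \<open>opmu\<close> takes the list
  \<open>ks = [k\<^sub>1, \<dots>, k\<^sub>n]\<close> of input arities as an argument.
\<close>

record 'a operad =
  ops :: "nat \<Rightarrow> 'a set"
  opid :: 'a
  opmu :: "nat list \<Rightarrow> 'a \<times> 'a list \<Rightarrow> 'a"

locale operad =
  fixes P :: "('a, 'e) operad_scheme"
  assumes opid_type: "opid P \<in> ops P 1"
    and opmu_type: "opmu P ks \<in> ops P (length ks) \<times> listset (map (ops P) ks)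
      \<rightarrow>\<^sub>E ops P (sum_list ks)"
    and opmu_unit_left: "x \<in> ops P n \<Longrightarrow> opmu P [n] (opid P, [x]) = x"
    and opmu_unit_right: "x \<in> ops P n \<Longrightarrow>
      opmu P (replicate n 1) (x, replicate n (opid P)) = x"
    and opmu_assoc: "x \<in> ops P (length lss) \<Longrightarrow> ys \<in> listset (map (\<lambda>ls. ops P (length ls)) lss) \<Longrightarrow>
      list_all2 (\<lambda>ls zs. zs \<in> listset (map (ops P) ls)) lss zss \<Longrightarrow>
      opmu P (concat lss) (opmu P (map length lss) (x, ys), concat zss) =
      opmu P (map sum_list lss)
        (x, map (\<lambda>(ls, y, zs). opmu P ls (y, zs)) (zip lss (zip ys zss)))"

definition operad_map ::
    "('a, 'd) operad_scheme \<Rightarrow> ('b, 'e) operad_scheme \<Rightarrow> (nat \<Rightarrow> 'a \<Rightarrow> 'b) \<Rightarrow> bool" where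
  "operad_map P Q f \<longleftrightarrow>
    (\<forall>n. f n \<in> ops P n \<rightarrow>\<^sub>E ops Q n) \<and>
    f 1 (opid P) = opid Q \<and>
    (\<forall>ks. \<forall>x \<in> ops P (length ks). \<forall>ys \<in> listset (map (ops P) ks).
      f (sum_list ks) (opmu P ks (x, ys)) = opmu Q ks (f (length ks) x, map2 f ks ys))"

subsection \<open>The operad of symmetric groups\<close>

text \<open>
  A permutation of \<open>{1..n}\<close> is a function fixing every number outside that interval. Since lists
  are indexed from 0, the \<open>i\<close>-th entry of \<open>xs\<close>, for \<open>i\<close> in \<open>{1..n}\<close>, is \<open>xs ! (i - 1)\<close>.

  A position \<open>p\<close> in \<open>{1..sum_list ks}\<close> is uniquely \<open>offset ks i + a\<close> with
  \<open>1 \<le> a \<le> ks ! (i - 1)\<close>, where \<open>i = block ks p\<close>.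
\<close>

definition offset :: "nat list \<Rightarrow> nat \<Rightarrow> nat" where
  "offset ks i = sum_list (take (i - 1) ks)"

definition block :: "nat list \<Rightarrow> nat \<Rightarrow> nat" where
  "block ks p = (LEAST i. p \<le> sum_list (take i ks))"

definition block_sum :: "nat list \<Rightarrow> (nat \<Rightarrow> nat) list \<Rightarrow> nat \<Rightarrow> nat" where
  "block_sum ks \<tau>s p = (if p \<in> {1..sum_list ks}
    then let i = block ks p; a = p - offset ks i in offset ks i + (\<tau>s ! (i - 1)) a
    else p)"

definition block_perm :: "nat list \<Rightarrow> (nat \<Rightarrow> nat) \<Rightarrow> nat \<Rightarrow> nat" where
  "block_perm ks \<sigma> p = (if p \<in> {1..sum_list ks}
    then let i = block ks p; a = p - offset ks i
      in (\<Sum>i' \<in> {i' \<in> {1..length ks}. \<sigma> i' < \<sigma> i}. ks ! (i' - 1)) + a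
    else p)"

definition symop :: "(nat \<Rightarrow> nat) operad" where
  "symop = \<lparr>
    ops = (\<lambda>n. carrier (sym_group n)),
    opid = \<one>\<^bsub>sym_group 1\<^esub>,
    opmu = (\<lambda>ks. \<lambda>(\<sigma>, \<tau>s) \<in> carrier (sym_group (length ks))
        \<times> listset (map (\<lambda>k. carrier (sym_group k)) ks).
      block_perm ks \<sigma> \<otimes>\<^bsub>sym_group (sum_list ks)\<^esub> block_sum ks \<tau>s)\<rparr>"

subsection \<open>Action operads\<close>

text \<open>\<open>select \<sigma> [x\<^sub>1, \<dots>, x\<^sub>n] = [x\<^bsub>\<sigma>(1)\<^esub>, \<dots>, x\<^bsub>\<sigma>(n)\<^esub>]\<close>\<close>

definition select :: "(nat \<Rightarrow> nat) \<Rightarrow> 'a list \<Rightarrow> 'a list" where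
  "select \<sigma> xs = map (\<lambda>i. xs ! (\<sigma> i - 1)) [1..<Suc (length xs)]"

record 'a action_operad = "'a operad" +
  grp :: "nat \<Rightarrow> 'a monoid"
  prm :: "nat \<Rightarrow> 'a \<Rightarrow> nat \<Rightarrow> nat"

locale action_operad = operad \<Lambda> for \<Lambda> :: "'a action_operad" +
  assumes carrier_grp: "carrier (grp \<Lambda> n) = ops \<Lambda> n"
    and mult_extensional: "case_prod (mult (grp \<Lambda> n)) \<in> extensional (ops \<Lambda> n \<times> ops \<Lambda> n)"
    and group_grp: "group (grp \<Lambda> n)"
    and prm_operad_map: "operad_map \<Lambda> symop (prm \<Lambda>)"
    and prm_hom: "prm \<Lambda> n \<in> hom (grp \<Lambda> n) (sym_group n)"
    and interchange: "g \<in> ops \<Lambda> (length ks) \<Longrightarrow> g' \<in> ops \<Lambda> (length ks) \<Longrightarrow>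
      fs \<in> listset (map (ops \<Lambda>) ks) \<Longrightarrow>
      fs' \<in> listset (map (ops \<Lambda>) (select (inv' (prm \<Lambda> (length ks) g)) ks)) \<Longrightarrow>
      opmu \<Lambda> (select (inv' (prm \<Lambda> (length ks) g)) ks) (g', fs')
        \<otimes>\<^bsub>grp \<Lambda> (sum_list ks)\<^esub> opmu \<Lambda> ks (g, fs) =
      opmu \<Lambda> ks (g' \<otimes>\<^bsub>grp \<Lambda> (length ks)\<^esub> g,
        map (\<lambda>(k, f', f). f' \<otimes>\<^bsub>grp \<Lambda> k\<^esub> f)
          (zip ks (zip (select (prm \<Lambda> (length ks) g) fs') fs)))"

definition aop_morphism ::
    "'a action_operad \<Rightarrow> 'b action_operad \<Rightarrow> (nat \<Rightarrow> 'a \<Rightarrow> 'b) \<Rightarrow> bool" where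
  "aop_morphism \<Lambda> \<Lambda>' f \<longleftrightarrow>
    action_operad \<Lambda> \<and> action_operad \<Lambda>' \<and>
    operad_map \<Lambda> \<Lambda>' f \<and>
    (\<forall>n. \<forall>x \<in> ops \<Lambda> n. prm \<Lambda>' n (f n x) = prm \<Lambda> n x) \<and>
    (\<forall>n. f n \<in> hom (grp \<Lambda> n) (grp \<Lambda>' n))"

definition AOp ::
    "('a action_operad, 'a action_operad \<times> (nat \<Rightarrow> 'a \<Rightarrow> 'a) \<times> 'a action_operad) cat" where
  "AOp = (let arrows = {(\<Lambda>, f, \<Lambda>'). aop_morphism \<Lambda> \<Lambda>' f} in \<lparr>
    Obj = {\<Lambda>. action_operad \<Lambda>},
    Arr = arrows,
    Dom = (\<lambda>(\<Lambda>, f, \<Lambda>') \<in> arrows. \<Lambda>),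
    Cod = (\<lambda>(\<Lambda>, f, \<Lambda>') \<in> arrows. \<Lambda>'),
    Ident = (\<lambda>\<Lambda> \<in> {\<Lambda>. action_operad \<Lambda>}. (\<Lambda>, (\<lambda>n. \<lambda>x \<in> ops \<Lambda> n. x), \<Lambda>)),
    Comp = (\<lambda>((\<Lambda>', g, \<Lambda>''), (\<Lambda>, f, \<Gamma>)) \<in>
        {((\<Lambda>', g, \<Lambda>''), (\<Lambda>, f, \<Gamma>)). (\<Lambda>', g, \<Lambda>'') \<in> arrows \<and> (\<Lambda>, f, \<Gamma>) \<in> arrows \<and> \<Lambda>' = \<Gamma>}.
      (\<Lambda>, (\<lambda>n. compose (ops \<Lambda> n) (g n) (f n)), \<Lambda>''))\<rparr>)"

section \<open>Clubs\<close>

text \<open>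
  The groupoid with objects the natural numbers associated with a family of groups. As the groups
  need not be disjoint, its arrows \<open>n \<rightarrow> n\<close> are the pairs \<open>(n, g)\<close> with \<open>g\<close> in \<open>G n\<close>.
\<close>

definition deloop :: "(nat \<Rightarrow> 'a monoid) \<Rightarrow> (nat, nat \<times> 'a) cat" where
  "deloop G = (let arrows = (SIGMA n : UNIV. carrier (G n)) in \<lparr>
    Obj = UNIV,
    Arr = arrows,
    Dom = (\<lambda>(n, g) \<in> arrows. n),
    Cod = (\<lambda>(n, g) \<in> arrows. n),
    Ident = (\<lambda>n. (n, \<one>\<^bsub>G n\<^esub>)),
    Comp = (\<lambda>((n, g), (l, f)) \<in> {((n, g), (l, f)). (n, g) \<in> arrows \<and> (l, f) \<in> arrows \<and> n = l}.
      (n, g \<otimes>\<^bsub>G n\<^esub> f))\<rparr>)"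

abbreviation BSigma :: "(nat, nat \<times> (nat \<Rightarrow> nat)) cat" where
  "BSigma \<equiv> deloop sym_group"

record ('o, 'm) club =
  ucat :: "('o, 'm) cat"
  prj :: "('o, 'm, nat, nat \<times> (nat \<Rightarrow> nat)) funct"
  mlt :: "('o \<times> 'o list, 'm \<times> 'm list, 'o, 'm) funct"
  unt :: 'o

definition prm_of :: "('o, 'm, nat, nat \<times> (nat \<Rightarrow> nat)) funct \<Rightarrow> 'm \<Rightarrow> nat \<Rightarrow> nat" where
  "prm_of k f = snd (amap k f)"

text \<open>
  The category \<open>K \<circ> K\<close>. An arrow \<open>(x; y\<^sub>1, \<dots>, y\<^sub>n) \<rightarrow> (z; w\<^sub>1, \<dots>, w\<^sub>n)\<close> is given by
  \<open>f : x \<rightarrow> z\<close> and \<open>g\<^sub>i : y\<^sub>i \<rightarrow> w\<^bsub>\<sigma>(i)\<^esub>\<close>, where \<open>\<sigma>\<close> is the permutation of \<open>f\<close>. It is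
  represented by \<open>(f, [g\<^sub>1, \<dots>, g\<^sub>n])\<close>, which determines its codomain:
  \<open>w\<^sub>j\<close> is the codomain of the entry of \<open>gs\<close> with index \<open>\<sigma>\<^sup>-\<^sup>1(j)\<close>.
\<close>

definition circ_obj ::
    "('o, 'm) cat \<Rightarrow> ('o, 'm, nat, nat \<times> (nat \<Rightarrow> nat)) funct \<Rightarrow> ('o \<times> 'o list) set" where
  "circ_obj C k = {(x, ys). x \<in> Obj C \<and> set ys \<subseteq> Obj C \<and> length ys = omap k x}"

definition circ_arr ::
    "('o, 'm) cat \<Rightarrow> ('o, 'm, nat, nat \<times> (nat \<Rightarrow> nat)) funct \<Rightarrow> ('m \<times> 'm list) set" where
  "circ_arr C k = {(f, gs). f \<in> Arr C \<and> set gs \<subseteq> Arr C \<and> length gs = omap k (Dom C f)}"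

definition circ_dom :: "('o, 'm) cat \<Rightarrow> 'm \<times> 'm list \<Rightarrow> 'o \<times> 'o list" where
  "circ_dom C = (\<lambda>(f, gs). (Dom C f, map (Dom C) gs))"

definition circ_cod :: "('o, 'm) cat \<Rightarrow> ('o, 'm, nat, nat \<times> (nat \<Rightarrow> nat)) funct
    \<Rightarrow> 'm \<times> 'm list \<Rightarrow> 'o \<times> 'o list" where
  "circ_cod C k = (\<lambda>(f, gs). (Cod C f, select (inv' (prm_of k f)) (map (Cod C) gs)))"

definition circ :: "('o, 'm) cat \<Rightarrow> ('o, 'm, nat, nat \<times> (nat \<Rightarrow> nat)) funct
    \<Rightarrow> ('o \<times> 'o list, 'm \<times> 'm list) cat" where
  "circ C k = \<lparr>
    Obj = circ_obj C k,
    Arr = circ_arr C k,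
    Dom = restrict (circ_dom C) (circ_arr C k),
    Cod = restrict (circ_cod C k) (circ_arr C k),
    Ident = (\<lambda>(x, ys) \<in> circ_obj C k. (Ident C x, map (Ident C) ys)),
    Comp = (\<lambda>((f', gs'), (f, gs)) \<in>
        {(q, p). q \<in> circ_arr C k \<and> p \<in> circ_arr C k \<and> circ_dom C q = circ_cod C k p}.
      (Comp C (f', f), map (Comp C) (zip (select (prm_of k f) gs') gs)))\<rparr>"

definition circ_prj :: "('o, 'm) cat \<Rightarrow> ('o, 'm, nat, nat \<times> (nat \<Rightarrow> nat)) funct
    \<Rightarrow> ('o \<times> 'o list, 'm \<times> 'm list, nat, nat \<times> (nat \<Rightarrow> nat)) funct" where
  "circ_prj C k = \<lparr>
    omap = (\<lambda>(x, ys) \<in> circ_obj C k. sum_list (map (omap k) ys)),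
    amap = (\<lambda>(f, gs) \<in> circ_arr C k.
      let ks = map (\<lambda>g. omap k (Dom C g)) gs
      in (sum_list ks, opmu symop ks (prm_of k f, map (prm_of k) gs)))\<rparr>"

text \<open>
  The two associativity laws are equality of the two functors
  \<open>(K \<circ> K) \<circ> K \<rightarrow> K\<close> on objects \<open>((x, ys), concat zss)\<close> and on arrows
  \<open>((f, gs), concat hss)\<close>; the block structure of the last list is determined by the rest.
\<close>

locale club =
  fixes K :: "('o, 'm) club"
  assumes prj_functor: "is_functor (ucat K) BSigma (prj K)"
    and mlt_functor: "is_functor (circ (ucat K) (prj K)) (ucat K) (mlt K)"
    and mlt_over: "comp_funct (circ (ucat K) (prj K)) (prj K) (mlt K) = circ_prj (ucat K) (prj K)"
    and unt_obj: "unt K \<in> Obj (ucat K)"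
    and prj_unt: "omap (prj K) (unt K) = 1"
    and unit_left_obj: "y \<in> Obj (ucat K) \<Longrightarrow> omap (mlt K) (unt K, [y]) = y"
    and unit_left_arr: "g \<in> Arr (ucat K) \<Longrightarrow> amap (mlt K) (Ident (ucat K) (unt K), [g]) = g"
    and unit_right_obj: "x \<in> Obj (ucat K) \<Longrightarrow>
      omap (mlt K) (x, replicate (omap (prj K) x) (unt K)) = x"
    and unit_right_arr: "f \<in> Arr (ucat K) \<Longrightarrow>
      amap (mlt K) (f, replicate (omap (prj K) (Dom (ucat K) f)) (Ident (ucat K) (unt K))) = f"
    and assoc_obj: "(x, ys) \<in> circ_obj (ucat K) (prj K) \<Longrightarrow>
      list_all2 (\<lambda>y zs. (y, zs) \<in> circ_obj (ucat K) (prj K)) ys zss \<Longrightarrow>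
      omap (mlt K) (omap (mlt K) (x, ys), concat zss) =
      omap (mlt K) (x, map (omap (mlt K)) (zip ys zss))"
    and assoc_arr: "(f, gs) \<in> circ_arr (ucat K) (prj K) \<Longrightarrow>
      list_all2 (\<lambda>g hs. (g, hs) \<in> circ_arr (ucat K) (prj K)) gs hss \<Longrightarrow>
      amap (mlt K) (amap (mlt K) (f, gs), concat hss) =
      amap (mlt K) (f, map (amap (mlt K)) (zip gs hss))"

definition club_morphism ::
    "('o, 'm) club \<Rightarrow> ('p, 'q) club \<Rightarrow> ('o, 'm, 'p, 'q) funct \<Rightarrow> bool" where
  "club_morphism K L F \<longleftrightarrow>
    club K \<and> club L \<and>
    is_functor (ucat K) (ucat L) F \<and>
    comp_funct (ucat K) (prj L) F = prj K \<and>
    (\<forall>(x, ys) \<in> circ_obj (ucat K) (prj K).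
      omap F (omap (mlt K) (x, ys)) = omap (mlt L) (omap F x, map (omap F) ys)) \<and>
    (\<forall>(f, gs) \<in> circ_arr (ucat K) (prj K).
      amap F (amap (mlt K) (f, gs)) = amap (mlt L) (amap F f, map (amap F) gs)) \<and>
    omap F (unt K) = unt L"

definition clubs_isomorphic :: "('o, 'm) club \<Rightarrow> ('p, 'q) club \<Rightarrow> bool" where
  "clubs_isomorphic K L \<longleftrightarrow> (\<exists>F G. club_morphism K L F \<and> club_morphism L K G \<and>
    comp_funct (ucat K) G F = id_funct (ucat K) \<and> comp_funct (ucat L) F G = id_funct (ucat L))"

definition Clubs :: "(('o, 'm) club,
    ('o, 'm) club \<times> ('o, 'm, 'o, 'm) funct \<times> ('o, 'm) club) cat" where
  "Clubs = (let arrows = {(K, F, L). club_morphism K L F} in \<lparr>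
    Obj = {K. club K},
    Arr = arrows,
    Dom = (\<lambda>(K, F, L) \<in> arrows. K),
    Cod = (\<lambda>(K, F, L) \<in> arrows. L),
    Ident = (\<lambda>K \<in> {K. club K}. (K, id_funct (ucat K), K)),
    Comp = (\<lambda>((L, G, M), (K, F, N)) \<in>
        {((L, G, M), (K, F, N)). (L, G, M) \<in> arrows \<and> (K, F, N) \<in> arrows \<and> L = N}.
      (K, comp_funct (ucat K) G F, M))\<rparr>)"

subsection \<open>The club of an action operad\<close>

definition Bprj :: "'a action_operad \<Rightarrow> (nat, nat \<times> 'a, nat, nat \<times> (nat \<Rightarrow> nat)) funct" where
  "Bprj \<Lambda> = \<lparr>omap = (\<lambda>n. n), amap = (\<lambda>(n, g) \<in> Arr (deloop (grp \<Lambda>)). (n, prm \<Lambda> n g))\<rparr>"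

definition Bclub :: "'a action_operad \<Rightarrow> (nat, nat \<times> 'a) club" where
  "Bclub \<Lambda> = \<lparr>
    ucat = deloop (grp \<Lambda>),
    prj = Bprj \<Lambda>,
    mlt = \<lparr>
      omap = (\<lambda>(n, ks) \<in> circ_obj (deloop (grp \<Lambda>)) (Bprj \<Lambda>). sum_list ks),
      amap = (\<lambda>((n, f), gs) \<in> circ_arr (deloop (grp \<Lambda>)) (Bprj \<Lambda>).
        (sum_list (map fst gs), opmu \<Lambda> (map fst gs) (f, map snd gs)))\<rparr>,
    unt = 1\<rparr>"

definition Bmor :: "'a action_operad \<Rightarrow> (nat \<Rightarrow> 'a \<Rightarrow> 'b)
    \<Rightarrow> (nat, nat \<times> 'a, nat, nat \<times> 'b) funct" where
  "Bmor \<Lambda> f = \<lparr>omap = (\<lambda>n. n), amap = (\<lambda>(n, g) \<in> Arr (deloop (grp \<Lambda>)). (n, f n g))\<rparr>"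

definition B_functor :: "('a action_operad,
    'a action_operad \<times> (nat \<Rightarrow> 'a \<Rightarrow> 'a) \<times> 'a action_operad,
    (nat, nat \<times> 'a) club,
    (nat, nat \<times> 'a) club \<times> (nat, nat \<times> 'a, nat, nat \<times> 'a) funct \<times> (nat, nat \<times> 'a) club) funct" where
  "B_functor = \<lparr>
    omap = restrict Bclub (Obj AOp),
    amap = (\<lambda>(\<Lambda>, f, \<Lambda>') \<in> Arr AOp. (Bclub \<Lambda>, Bmor \<Lambda> f, Bclub \<Lambda>'))\<rparr>"

end

theory Submission
  imports Defs
begin

text \<open>
  Functoriality of \<open>m\<close> on \<open>K \<circ> K\<close> is precisely the interchange axiom of an action operad, and the
  requirement that \<open>m\<close> lies over \<open>B\<Sigma>\<close> says precisely that \<open>\<pi>\<close> is a map of operads. A club whose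
  projection is bijective on objects has only endomorphisms, since permutations preserve the arity;
  if it is a groupoid, its automorphism groups therefore form an action operad under \<open>m\<close>, and
  reading off these groups inverts \<open>\<Lambda> \<mapsto> B\<Lambda>\<close>. The only datum of \<open>\<Lambda>\<close> that is not visibly part of
  \<open>B\<Lambda>\<close> is the operadic identity, which has to be shown equal to the unit of the group \<open>\<Lambda>(1)\<close>.
\<close>

text \<open>Most of the work comes from the two forms in which a permutation acts on the list part
  of an arrow of \<open>circ C k\<close>. The codomain list is permuted by the inverse of the
  permutation of \<open>f\<close>, while composition pulls the outer list back by the permutation
  itself. The interchange axiom contains the same pair: the arities of \<open>fs'\<close> are
  permuted by the inverse, the entries of \<open>fs'\<close> are selected by the permutation.
  Rewriting composability in the pulled-back form puts arrows that meet at equal positions, and the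
  laws can then be checked entry by entry. That \<open>m\<close> preserves identities is not an
  axiom of an action operad. It follows from interchange, because an element of a group that equals
  its own square is the unit. The two directions store arities differently. An arrow of B\<Lambda>
  is a pair carrying its arity, since the groups \<Lambda>(n) may overlap; an arrow of
  \<open>K\<close> has its arity determined by its domain, so the groups read off from
  \<open>K\<close> are disjoint sets of arrows. Passing between the two means adding or forgetting
  this tag.\<close>

section \<open>Permuted lists and functors\<close>

text \<open>\<open>listset\<close> builds a product of sets by recursion; the indexed form is what
  the entrywise arguments need.\<close>

lemma in_listset_iff:
  "xs \<in> listset As \<longleftrightarrow> length xs = length As \<and> (\<forall>i < length As. xs ! i \<in> As ! i)"
proof (induction As arbitrary: xs)
  case (Cons A As)
  then show ?case
    by (cases xs) (auto simp: set_Cons_def less_Suc_eq_0_disj)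
qed simp

lemma length_select [simp]: "length (select \<sigma> xs) = length xs"
  by (simp add: select_def del: upt_Suc)

lemma nth_select [simp]: "i < length xs \<Longrightarrow> select \<sigma> xs ! i = xs ! (\<sigma> (Suc i) - 1)"
  by (simp add: select_def del: upt_Suc)

text \<open>Positions in lists start at 0 and permutations act on \<open>{1..n}\<close>. The shifted
  index stays in range, and the truncated subtraction loses nothing because the value of the
  permutation is positive.\<close>

lemma permutes_index_less:
  assumes "\<sigma> permutes {1..n}" "i < n"
  shows "\<sigma> (Suc i) - Suc 0 < n" "Suc (\<sigma> (Suc i) - Suc 0) = \<sigma> (Suc i)"
  using permutes_in_image[OF assms(1), of "Suc i"] assms(2) by auto

lemma select_map:
  assumes "\<sigma> permutes {1..length xs}"
  shows "select \<sigma> (map f xs) = map f (select \<sigma> xs)"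
  using permutes_index_less[OF assms] by (intro nth_equalityI) auto

lemma select_id [simp]: "select id xs = xs"
  by (intro nth_equalityI) auto

text \<open>\<open>select\<close> is a right action: position i of the result reads position
  \<tau>(i) of \<open>select \<sigma> xs\<close>, hence position \<sigma>(\<tau>(i)) of
  \<open>xs\<close>.\<close>

lemma select_select:
  assumes "\<tau> permutes {1..length xs}"
  shows "select \<tau> (select \<sigma> xs) = select (\<sigma> \<circ> \<tau>) xs"
  using permutes_index_less[OF assms] by (intro nth_equalityI) auto

lemma select_inverse:
  assumes "\<sigma> permutes {1..length xs}"
  shows "select \<sigma> (select (inv' \<sigma>) xs) = xs" "select (inv' \<sigma>) (select \<sigma> xs) = xs"
  using assms by (simp_all add: select_select permutes_inv permutes_inv_o)

lemma set_select:
  assumes "\<sigma> permutes {1..length xs}"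
  shows "set (select \<sigma> xs) \<subseteq> set xs"
  using permutes_index_less[OF assms] by (fastforce simp: in_set_conv_nth)

text \<open>The multiset of positions is invariant under \<open>\<sigma>\<close>, so the same
  entries are read in another order. The consequence wanted is that the total arity does not change
  when the inputs are permuted.\<close>

lemma mset_select:
  assumes "\<sigma> permutes {1..length xs}"
  shows "mset (select \<sigma> xs) = mset xs"
proof -
  let ?n = "length xs"
  have "mset (select \<sigma> xs) = image_mset (\<lambda>i. xs ! (i - 1)) (image_mset \<sigma> (mset_set {1..?n}))"
    by (simp add: select_def image_mset.compositionality o_def atLeastLessThanSuc_atLeastAtMost
        del: upt_Suc)
  also have "image_mset \<sigma> (mset_set {1..?n}) = mset_set {1..?n}"
    using assms by (simp add: permutes_image image_mset_mset_set permutes_inj_on)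
  also have "image_mset (\<lambda>i. xs ! (i - 1)) (mset_set {1..?n}) = mset (select id xs)"
    by (simp add: select_def atLeastLessThanSuc_atLeastAtMost del: upt_Suc)
  finally show ?thesis by simp
qed

lemma sum_list_select:
  fixes ks :: "nat list"
  assumes "\<sigma> permutes {1..length ks}"
  shows "sum_list (select \<sigma> ks) = sum_list ks"
  by (metis assms mset_select sum_mset_sum_list)

section \<open>Rules for categories and functors\<close>

context category
begin

lemma Dom_closed [simp]: "f \<in> Arr C \<Longrightarrow> Dom C f \<in> Obj C"
  using Dom_type by auto

lemma Cod_closed [simp]: "f \<in> Arr C \<Longrightarrow> Cod C f \<in> Obj C"
  using Cod_type by auto

lemma Ident_closed [simp]:
  assumes "x \<in> Obj C"
  shows "Ident C x \<in> Arr C" "Dom C (Ident C x) = x" "Cod C (Ident C x) = x"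
  using Ident_Hom[OF assms] by (auto simp: Hom_def)

lemma Comp_closed [simp]:
  assumes "g \<in> Arr C" "f \<in> Arr C" "Dom C g = Cod C f"
  shows "Comp C (g, f) \<in> Arr C" "Dom C (Comp C (g, f)) = Dom C f" "Cod C (Comp C (g, f)) = Cod C g"
  using Comp_Hom[of g f] assms by (auto simp: Hom_def composable_def)

lemma assoc:
  assumes "h \<in> Arr C" "g \<in> Arr C" "f \<in> Arr C" "Dom C h = Cod C g" "Dom C g = Cod C f"
  shows "Comp C (Comp C (h, g), f) = Comp C (h, Comp C (g, f))"
  using assms Comp_assoc[of h g f] by (auto simp: composable_def)

end

context is_functor
begin

lemma omap_closed [simp]: "x \<in> Obj C \<Longrightarrow> omap F x \<in> Obj D"
  using omap_type by auto

lemma amap_closed [simp]: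
  assumes "f \<in> Arr C"
  shows "amap F f \<in> Arr D" "Dom D (amap F f) = omap F (Dom C f)" "Cod D (amap F f) = omap F (Cod C f)"
  using amap_Hom[OF assms] by (auto simp: Hom_def)

lemma amap_comp:
  "g \<in> Arr C \<Longrightarrow> f \<in> Arr C \<Longrightarrow> Dom C g = Cod C f \<Longrightarrow>
    amap F (Comp C (g, f)) = Comp D (amap F g, amap F f)"
  using amap_Comp[of g f] by (auto simp: composable_def)

end

lemma is_functor_id_funct:
  assumes "category C"
  shows "is_functor C C (id_funct C)"
proof -
  interpret category C by fact
  show ?thesis
    by unfold_locales (auto simp: id_funct_def Hom_def composable_def)
qed

lemma is_functor_comp_funct:
  assumes "is_functor C D F" "is_functor D E G"
  shows "is_functor C E (comp_funct C G F)"
proof -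
  interpret F: is_functor C D F by fact
  interpret G: is_functor D E G by fact
  show ?thesis
    by unfold_locales
      (auto simp: comp_funct_def Hom_def composable_def compose_def F.amap_comp G.amap_comp
        F.amap_Ident G.amap_Ident)
qed

text \<open>Strict equality of records holds because both maps of a functor are
  \<open>undefined\<close> off its source.\<close>

lemma comp_funct_id_funct:
  assumes "is_functor C D F"
  shows "comp_funct C (id_funct D) F = F" "comp_funct C F (id_funct C) = F"
proof -
  interpret F: is_functor C D F by fact
  have "compose (Obj C) (\<lambda>x\<in>Obj D. x) (omap F) = omap F"
    "compose (Arr C) (\<lambda>x\<in>Arr D. x) (amap F) = amap F"
    "compose (Obj C) (omap F) (\<lambda>x\<in>Obj C. x) = omap F"
    "compose (Arr C) (amap F) (\<lambda>x\<in>Arr C. x) = amap F"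
    using F.omap_type F.amap_type
    by (auto simp: compose_def fun_eq_iff PiE_def extensional_def)
  then show "comp_funct C (id_funct D) F = F" "comp_funct C F (id_funct C) = F"
    by (simp_all add: comp_funct_def id_funct_def)
qed

text \<open>The functor \<open>F\<close> takes values in \<open>D\<close>, so restricting the
  composite of \<open>H\<close> and \<open>G\<close> to \<open>D\<close> changes none of the values
  that are used.\<close>

lemma comp_funct_assoc:
  assumes "is_functor C D F"
  shows "comp_funct C (comp_funct D H G) F = comp_funct C H (comp_funct C G F)"
proof -
  interpret F: is_functor C D F by fact
  show ?thesis
    by (auto simp: comp_funct_def compose_def fun_eq_iff)
qed

section \<open>The groupoid of a family of groups\<close>

lemma deloop_simps [simp]:
  "Obj (deloop G) = UNIV"
  "Arr (deloop G) = (SIGMA n : UNIV. carrier (G n))"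
  "p \<in> (SIGMA n : UNIV. carrier (G n)) \<Longrightarrow> Dom (deloop G) p = fst p"
  "p \<in> (SIGMA n : UNIV. carrier (G n)) \<Longrightarrow> Cod (deloop G) p = fst p"
  "Ident (deloop G) n = (n, \<one>\<^bsub>G n\<^esub>)"
  "g \<in> carrier (G n) \<Longrightarrow> f \<in> carrier (G n) \<Longrightarrow>
    Comp (deloop G) ((n, g), (n, f)) = (n, g \<otimes>\<^bsub>G n\<^esub> f)"
  by (auto simp: deloop_def Let_def)

lemma category_deloop:
  assumes "\<And>n. group (G n)"
  shows "category (deloop G)"
proof -
  interpret group "G n" for n by fact
  show ?thesis
  proof unfold_locales
    show "Dom (deloop G) \<in> Arr (deloop G) \<rightarrow>\<^sub>E Obj (deloop G)"
      "Cod (deloop G) \<in> Arr (deloop G) \<rightarrow>\<^sub>E Obj (deloop G)"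
      "Comp (deloop G) \<in> composable (deloop G) \<rightarrow>\<^sub>E Arr (deloop G)"
      by (auto simp: deloop_def Let_def composable_def extensional_def split: if_splits)
  qed (auto simp: composable_def Hom_def m_assoc)
qed

section \<open>The category of composable pairs\<close>

lemma mem_circ_obj [simp]:
  "(x, ys) \<in> circ_obj C k \<longleftrightarrow> x \<in> Obj C \<and> set ys \<subseteq> Obj C \<and> length ys = omap k x"
  by (simp add: circ_obj_def)

lemma mem_circ_arr [simp]:
  "(f, gs) \<in> circ_arr C k \<longleftrightarrow> f \<in> Arr C \<and> set gs \<subseteq> Arr C \<and> length gs = omap k (Dom C f)"
  by (simp add: circ_arr_def)

lemma circ_simps [simp]:
  "Obj (circ C k) = circ_obj C k"
  "Arr (circ C k) = circ_arr C k"
  "(f, gs) \<in> circ_arr C k \<Longrightarrow> Dom (circ C k) (f, gs) = (Dom C f, map (Dom C) gs)"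
  "(f, gs) \<in> circ_arr C k \<Longrightarrow>
    Cod (circ C k) (f, gs) = (Cod C f, select (inv' (prm_of k f)) (map (Cod C) gs))"
  "(x, ys) \<in> circ_obj C k \<Longrightarrow> Ident (circ C k) (x, ys) = (Ident C x, map (Ident C) ys)"
  by (simp_all add: circ_def circ_dom_def circ_cod_def)

lemma Comp_circ:
  assumes "(f', gs') \<in> circ_arr C k" "(f, gs) \<in> circ_arr C k"
    and "Dom C f' = Cod C f" "map (Dom C) gs' = select (inv' (prm_of k f)) (map (Cod C) gs)"
  shows "Comp (circ C k) ((f', gs'), (f, gs)) =
    (Comp C (f', f), map (Comp C) (zip (select (prm_of k f) gs') gs))"
  using assms by (simp add: circ_def circ_dom_def circ_cod_def)

text \<open>A category over B\<Sigma>, which is all that the formation of \<open>circ C k\<close>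
  requires. Clubs and the groupoids of action operads are both instances.\<close>

locale collection = is_functor C BSigma k
  for C :: "('o, 'm) cat" and k :: "('o, 'm, nat, nat \<times> (nat \<Rightarrow> nat)) funct"
begin

lemma amap_eq:
  assumes "f \<in> Arr C"
  shows "amap k f = (omap k (Dom C f), prm_of k f)"
  using amap_closed[OF assms] by (auto simp: prm_of_def)

text \<open>B\<Sigma> has no arrows between different numbers.\<close>

lemma omap_Cod [simp]:
  assumes "f \<in> Arr C"
  shows "omap k (Cod C f) = omap k (Dom C f)"
  using amap_closed[OF assms] by auto

lemma prm_of_permutes:
  assumes "f \<in> Arr C"
  shows "prm_of k f permutes {1..omap k (Dom C f)}"
  using amap_closed[OF assms] by (auto simp: prm_of_def sym_group_carrier)

lemma prm_of_Ident [simp]: "x \<in> Obj C \<Longrightarrow> prm_of k (Ident C x) = id"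
  by (simp add: prm_of_def amap_Ident sym_group_one)

lemma prm_of_Comp [simp]:
  assumes "g \<in> Arr C" "f \<in> Arr C" "Dom C g = Cod C f"
  shows "prm_of k (Comp C (g, f)) = prm_of k g \<circ> prm_of k f"
proof -
  have n: "omap k (Dom C g) = omap k (Dom C f)"
    using assms by simp
  have "amap k (Comp C (g, f)) =
      Comp BSigma ((omap k (Dom C f), prm_of k g), (omap k (Dom C f), prm_of k f))"
    using assms amap_comp[of g f] amap_eq[of g] amap_eq[of f] n by simp
  also have "\<dots> = (omap k (Dom C f), prm_of k g \<circ> prm_of k f)"
    using prm_of_permutes[of g] prm_of_permutes[of f] assms(1,2) n
    by (simp add: sym_group_carrier sym_group_mult)
  finally show ?thesis
    by (simp add: prm_of_def)
qed

lemma select_prm_of: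
  assumes "f \<in> Arr C" "length xs = omap k (Dom C f)"
  shows "select (prm_of k f) (map h xs) = map h (select (prm_of k f) xs)"
    and "set (select (prm_of k f) xs) \<subseteq> set xs"
    and "set (select (inv' (prm_of k f)) xs) \<subseteq> set xs"
  using prm_of_permutes[OF assms(1)] assms(2)
  by (simp_all add: select_map set_select permutes_inv)

lemma select_prm_of_inverse:
  assumes "f \<in> Arr C" "length xs = omap k (Dom C f)"
  shows "select (prm_of k f) (select (inv' (prm_of k f)) xs) = xs"
    and "select (inv' (prm_of k f)) (select (prm_of k f) xs) = xs"
  using prm_of_permutes[OF assms(1)] assms(2) by (simp_all add: select_inverse)

text \<open>By definition the domains of \<open>gs'\<close> are compared with the permuted codomains
  of \<open>gs\<close>. Applying \<open>select (prm_of k f)\<close> to both sides cancels the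
  inverse and moves the permutation to \<open>gs'\<close>. In this form arrows that meet stand at
  the same position.\<close>

lemma composable_circ:
  "(p, q) \<in> composable (circ C k) \<longleftrightarrow> (case (p, q) of ((f', gs'), (f, gs)) \<Rightarrow>
    (f', gs') \<in> circ_arr C k \<and> (f, gs) \<in> circ_arr C k \<and> Dom C f' = Cod C f \<and>
    map (Dom C) (select (prm_of k f) gs') = map (Cod C) gs)"
proof (cases p; cases q)
  fix f' gs' f gs assume p: "p = (f', gs')" and q: "q = (f, gs)"
  have "map (Dom C) gs' = select (inv' (prm_of k f)) (map (Cod C) gs) \<longleftrightarrow>
      map (Dom C) (select (prm_of k f) gs') = map (Cod C) gs"
    if "f \<in> Arr C" "length gs' = omap k (Dom C f)" "length gs = omap k (Dom C f)"
    using that select_prm_of_inverse[of f "map (Dom C) gs'"]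
      select_prm_of_inverse[of f "map (Cod C) gs"] select_prm_of(1)[of f gs' "Dom C"]
    by (metis length_map)
  then have *: "map (Dom C) gs' = select (inv' (prm_of k f)) (map (Cod C) gs) \<longleftrightarrow>
      map (Dom C) (select (prm_of k f) gs') = map (Cod C) gs"
    if "(f', gs') \<in> circ_arr C k" "(f, gs) \<in> circ_arr C k" "Dom C f' = Cod C f"
    using that by simp
  have "(p, q) \<in> composable (circ C k) \<longleftrightarrow>
      (f', gs') \<in> circ_arr C k \<and> (f, gs) \<in> circ_arr C k \<and> Dom C f' = Cod C f \<and>
      map (Dom C) gs' = select (inv' (prm_of k f)) (map (Cod C) gs)"
    unfolding p q by (auto simp: composable_def simp del: mem_circ_arr)
  then show ?thesis
    unfolding p q prod.case using * by blast
qed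

lemma Comp_circ_composable:
  assumes "((f', gs'), (f, gs)) \<in> composable (circ C k)"
  shows "Comp (circ C k) ((f', gs'), (f, gs)) =
    (Comp C (f', f), map (Comp C) (zip (select (prm_of k f) gs') gs))"
  using assms by (intro Comp_circ) (auto simp: composable_def simp del: mem_circ_arr)

lemma Dom_Cod_Comp_lists:
  assumes "set gs' \<subseteq> Arr C" "set gs \<subseteq> Arr C" "map (Dom C) gs' = map (Cod C) gs"
  shows "set (map (Comp C) (zip gs' gs)) \<subseteq> Arr C"
    and "map (Dom C) (map (Comp C) (zip gs' gs)) = map (Dom C) gs"
    and "map (Cod C) (map (Comp C) (zip gs' gs)) = map (Cod C) gs'"
proof -
  have len: "length gs' = length gs"
    using assms(3) by (metis length_map)
  have *: "gs' ! i \<in> Arr C" "gs ! i \<in> Arr C" "Dom C (gs' ! i) = Cod C (gs ! i)" if "i < length gs" for i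
    using that assms len by (auto dest: nth_mem simp: list_eq_iff_nth_eq)
  show "set (map (Comp C) (zip gs' gs)) \<subseteq> Arr C"
    "map (Dom C) (map (Comp C) (zip gs' gs)) = map (Dom C) gs"
    "map (Cod C) (map (Comp C) (zip gs' gs)) = map (Cod C) gs'"
    using * len by (auto simp: in_set_conv_nth intro!: nth_equalityI)
qed

text \<open>Only the codomain is delicate. With \<sigma> and \<tau> the permutations of
  \<open>f\<close> and \<open>f'\<close>, the inverse of \<tau>\<sigma> has the inverse of \<sigma>
  as its left factor, and this cancels against the \<sigma> by which \<open>gs'\<close> was pulled
  back; what remains is the inverse of \<tau>.\<close>

lemma Comp_circ_closed:
  assumes "((f', gs'), (f, gs)) \<in> composable (circ C k)"
  shows "Comp (circ C k) ((f', gs'), (f, gs)) \<in> Hom (circ C k)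
    (Dom (circ C k) (f, gs)) (Cod (circ C k) (f', gs'))"
proof -
  note c = assms[unfolded composable_circ prod.case]
  let ?hs = "map (Comp C) (zip (select (prm_of k f) gs') gs)"
  have len: "length gs' = omap k (Dom C f)" "length gs = omap k (Dom C f)"
    using c by auto
  have f: "f \<in> Arr C" "f' \<in> Arr C" "Dom C f' = Cod C f"
    using c by auto
  have "set (select (prm_of k f) gs') \<subseteq> Arr C"
    using select_prm_of(2)[OF f(1) len(1)] c by auto
  note hs = Dom_Cod_Comp_lists[OF this, of gs]
  have \<sigma>: "prm_of k f permutes {1..length gs'}" "prm_of k f' permutes {1..length gs'}"
    using prm_of_permutes[of f] prm_of_permutes[of f'] f len by simp_all
  have "select (inv' (prm_of k f' \<circ> prm_of k f)) (map (Cod C) ?hs) =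
      select (inv' (prm_of k f) \<circ> inv' (prm_of k f')) (map (Cod C) (select (prm_of k f) gs'))"
    using hs c o_inv_distrib[OF permutes_bij[OF \<sigma>(2)] permutes_bij[OF \<sigma>(1)]] by simp
  also have "\<dots> = select (prm_of k f \<circ> (inv' (prm_of k f) \<circ> inv' (prm_of k f'))) (map (Cod C) gs')"
    using \<sigma> by (simp add: select_map[symmetric] select_select permutes_compose permutes_inv)
  also have "\<dots> = select (inv' (prm_of k f')) (map (Cod C) gs')"
    by (simp only: o_assoc permutes_inv_o[OF \<sigma>(1)] id_o)
  finally show ?thesis
    using c hs f len unfolding Comp_circ_composable[OF assms] by (auto simp: Hom_def)
qed

lemma category_circ: "category (circ C k)"
proof
  show "Dom (circ C k) \<in> Arr (circ C k) \<rightarrow>\<^sub>E Obj (circ C k)"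
    by (auto simp: circ_def circ_dom_def subset_iff)
  show "Cod (circ C k) \<in> Arr (circ C k) \<rightarrow>\<^sub>E Obj (circ C k)"
  proof -
    have "circ_cod C k (f, gs) \<in> circ_obj C k" if "(f, gs) \<in> circ_arr C k" for f gs
    proof -
      have "set (map (Cod C) gs) \<subseteq> Obj C"
        using that by auto
      from order_trans[OF select_prm_of(3) this] that show ?thesis
        by (simp add: circ_cod_def)
    qed
    then show ?thesis
      by (force simp: circ_def)
  qed
  show "Ident (circ C k) \<in> Obj (circ C k) \<rightarrow>\<^sub>E Arr (circ C k)"
    by (auto simp: circ_def subset_iff)
  have "Comp (circ C k) \<in> extensional (composable (circ C k))"
    by (auto simp: circ_def composable_def extensional_def)
  then show "Comp (circ C k) \<in> composable (circ C k) \<rightarrow>\<^sub>E Arr (circ C k)"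
    using Comp_circ_closed by (auto simp: PiE_def Hom_def)
  show "Ident (circ C k) x \<in> Hom (circ C k) x x" if "x \<in> Obj (circ C k)" for x
  proof (cases x)
    case (Pair a bs)
    have "(Ident C a, map (Ident C) bs) \<in> circ_arr C k"
      using that by (auto simp: Pair subset_iff)
    moreover have "map (Dom C) (map (Ident C) bs) = bs" "map (Cod C) (map (Ident C) bs) = bs"
      using that by (auto simp: Pair subset_iff intro!: map_idI)
    ultimately show ?thesis
      using that by (simp add: Pair Hom_def)
  qed
  show "Comp (circ C k) (g, f) \<in> Hom (circ C k) (Dom (circ C k) f) (Cod (circ C k) g)"
    if "(g, f) \<in> composable (circ C k)" for g f
    using that Comp_circ_closed by (cases g; cases f) auto
next
  fix p assume "p \<in> Arr (circ C k)"
  then obtain f gs where p: "p = (f, gs)" "f \<in> Arr C" "set gs \<subseteq> Arr C" "length gs = omap k (Dom C f)"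
    by (cases p) auto
  have 1: "map (Comp C) (zip (map (Ident C) (map (Cod C) gs)) gs) = gs"
    "map (Comp C) (zip gs (map (Ident C) (map (Dom C) gs))) = gs"
    using p(3) by (auto intro!: nth_equalityI simp: source.Ident_left source.Ident_right subset_iff)
  have \<sigma>: "prm_of k f permutes {1..length gs}"
    using p prm_of_permutes[of f] by simp
  have gs: "set (map (Cod C) gs) \<subseteq> Obj C" "set (map (Dom C) gs) \<subseteq> Obj C"
    using p(3) by auto
  have "set (select (inv' (prm_of k f)) (map (Cod C) gs)) \<subseteq> Obj C"
    using order_trans[OF select_prm_of(3)[of f "map (Cod C) gs"] gs(1)] p by simp
  then have Cod: "(Cod C f, select (inv' (prm_of k f)) (map (Cod C) gs)) \<in> circ_obj C k"
    using p by simp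
  have Dom: "(Dom C f, map (Dom C) gs) \<in> circ_obj C k"
    using p gs by simp
  \<comment> \<open>\<open>zs\<close> is the codomain list of \<open>p\<close>. Its identities are
    pulled back along \<open>f\<close> before composing, which restores the order of
    \<open>gs\<close>; the name keeps the selection folded in the meantime.\<close>
  define zs where "zs = select (inv' (prm_of k f)) (map (Cod C) gs)"
  have zs: "set zs \<subseteq> Obj C" "length zs = length gs" "select (prm_of k f) zs = map (Cod C) gs"
    using Cod \<sigma> by (simp_all add: zs_def select_inverse)
  have "(Ident C (Cod C f), map (Ident C) zs) \<in> circ_arr C k" "map (Dom C) (map (Ident C) zs) = zs"
    using p zs by (auto simp: subset_iff intro!: map_idI)
  moreover have "select (prm_of k f) (map (Ident C) zs) = map (Ident C) (map (Cod C) gs)"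
    using \<sigma> zs by (simp add: select_map)
  ultimately have "Comp (circ C k) (Ident (circ C k) (Cod (circ C k) p), p) =
      (Comp C (Ident C (Cod C f), f), map (Comp C) (zip (map (Ident C) (map (Cod C) gs)) gs))"
    using p Cod Comp_circ[of "Ident C (Cod C f)" "map (Ident C) zs" C k f gs]
    by (simp flip: zs_def)
  then show "Comp (circ C k) (Ident (circ C k) (Cod (circ C k) p), p) = p"
    using p 1(1) by (simp add: source.Ident_left)
  define ws where "ws = map (Dom C) gs"
  have ws: "set ws \<subseteq> Obj C" "length ws = length gs"
    using gs by (simp_all add: ws_def)
  have "(Ident C (Dom C f), map (Ident C) ws) \<in> circ_arr C k" "map (Cod C) (map (Ident C) ws) = ws"
    using p ws by (auto simp: subset_iff intro!: map_idI)
  then have "Comp (circ C k) (p, Ident (circ C k) (Dom (circ C k) p)) =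
      (Comp C (f, Ident C (Dom C f)), map (Comp C) (zip gs (map (Ident C) (map (Dom C) gs))))"
    using p Dom Comp_circ[of f gs C k "Ident C (Dom C f)" "map (Ident C) ws"]
    by (simp flip: ws_def)
  then show "Comp (circ C k) (p, Ident (circ C k) (Dom (circ C k) p)) = p"
    using p 1(2) by (simp add: source.Ident_right)
next
  fix p q r
  assume c: "(p, q) \<in> composable (circ C k)" "(q, r) \<in> composable (circ C k)"
  obtain h hs g gs f fs where pqr: "p = (h, hs)" "q = (g, gs)" "r = (f, fs)"
    by (metis surj_pair)
  note c = c[unfolded pqr]
  note c' = c[unfolded composable_circ prod.case]
  let ?\<sigma> = "prm_of k f" and ?\<tau> = "prm_of k g"
  let ?us = "map (Comp C) (zip (select ?\<tau> hs) gs)" and ?vs = "map (Comp C) (zip (select ?\<sigma> gs) fs)"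
  have Comp: "Comp (circ C k) (p, q) = (Comp C (h, g), ?us)" "Comp (circ C k) (q, r) = (Comp C (g, f), ?vs)"
    using c by (simp_all add: pqr Comp_circ_composable)
  have "(Comp (circ C k) (p, q), r) \<in> composable (circ C k)"
    "(p, Comp (circ C k) (q, r)) \<in> composable (circ C k)"
    using c Comp_circ_closed[OF c(1)] Comp_circ_closed[OF c(2)] by (auto simp: pqr composable_def Hom_def)
  note C2 = this[unfolded pqr Comp[unfolded pqr], THEN Comp_circ_composable]
  have lists: "set hs \<subseteq> Arr C" "set gs \<subseteq> Arr C" "set fs \<subseteq> Arr C"
      "map (Dom C) (select ?\<tau> hs) = map (Cod C) gs" "map (Dom C) (select ?\<sigma> gs) = map (Cod C) fs"
    and arrs: "h \<in> Arr C" "g \<in> Arr C" "f \<in> Arr C" "Dom C h = Cod C g" "Dom C g = Cod C f"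
    using c' unfolding mem_circ_arr by blast+
  have n: "length hs = omap k (Dom C f)" "length gs = omap k (Dom C f)" "length fs = omap k (Dom C f)"
  proof -
    have "f \<in> Arr C" "g \<in> Arr C" "Dom C g = Cod C f" "Dom C h = Cod C g"
      and "length hs = omap k (Dom C h)" "length gs = omap k (Dom C g)" "length fs = omap k (Dom C f)"
      using c' unfolding mem_circ_arr by blast+
    then show "length hs = omap k (Dom C f)" "length gs = omap k (Dom C f)" "length fs = omap k (Dom C f)"
      using omap_Cod[of f] omap_Cod[of g] by metis+
  qed
  have "f \<in> Arr C" "g \<in> Arr C"
    and eq: "omap k (Dom C g) = length fs" "omap k (Dom C f) = length fs"
    using c' n unfolding mem_circ_arr by metis+
  then have \<sigma>: "?\<sigma> permutes {1..length fs}" "?\<tau> permutes {1..length fs}"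
    using prm_of_permutes[of f] prm_of_permutes[of g] by simp_all
  have "map (Comp C) (zip (select ?\<sigma> ?us) fs) = map (Comp C) (zip (select (?\<tau> \<circ> ?\<sigma>) hs) ?vs)"
  proof (rule nth_equalityI)
    fix i assume "i < length (map (Comp C) (zip (select ?\<sigma> ?us) fs))"
    then have i: "i < length fs" by simp
    \<comment> \<open>Up to the shift by one, entry i of \<open>fs\<close> meets entry j =
      \<sigma>(i) of \<open>gs\<close>, which meets entry l = \<tau>(j) of \<open>hs\<close>. Both
      bracketings compose these three arrows, so associativity in \<open>C\<close> applies.\<close>
    define j where "j = ?\<sigma> (Suc i) - 1"
    define l where "l = ?\<tau> (Suc j) - 1"
    have j: "j < length fs" "?\<sigma> (Suc i) = Suc j"
      using permutes_index_less[OF \<sigma>(1) i] by (auto simp: j_def)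
    have l: "l < length fs" "?\<tau> (Suc j) = Suc l"
      using permutes_index_less[OF \<sigma>(2) j(1)] by (auto simp: l_def)
    have "hs ! l \<in> Arr C" "gs ! j \<in> Arr C" "fs ! i \<in> Arr C"
      using lists n i j l by (auto simp: subset_iff)
    moreover have "Dom C (gs ! j) = Cod C (fs ! i)"
      using arg_cong[OF lists(5), of "\<lambda>xs. xs ! i"] n i j by simp
    moreover have "Dom C (hs ! l) = Cod C (gs ! j)"
      using arg_cong[OF lists(4), of "\<lambda>xs. xs ! j"] n j l by simp
    ultimately show "map (Comp C) (zip (select ?\<sigma> ?us) fs) ! i =
        map (Comp C) (zip (select (?\<tau> \<circ> ?\<sigma>) hs) ?vs) ! i"
      using i j l n by (simp add: source.assoc)
  qed (use n in simp)
  then show "Comp (circ C k) (Comp (circ C k) (p, q), r) = Comp (circ C k) (p, Comp (circ C k) (q, r))"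
    unfolding Comp unfolding pqr(1,3) unfolding C2 using arrs by (simp add: source.assoc)
qed

end

section \<open>The club of an action operad\<close>

lemma in_listset_ops:
  "ys \<in> listset (map A ks) \<longleftrightarrow> length ys = length ks \<and> (\<forall>i < length ks. ys ! i \<in> A (ks ! i))"
  by (auto simp: in_listset_iff)

lemma sum_list_concat:
  fixes xss :: "'a :: monoid_add list list"
  shows "sum_list (concat xss) = sum_list (map sum_list xss)"
  by (induction xss) simp_all

text \<open>Separates tagged arrows into the arity list and the operations, which
  \<open>opmu\<close> takes as two arguments.\<close>

lemma map_snd_in_listset:
  "set gs \<subseteq> (SIGMA n : UNIV. A n) \<Longrightarrow> map snd gs \<in> listset (map A (map fst gs))"
  by (force simp: in_listset_ops subset_iff dest: nth_mem)

lemma map_Dom_deloop: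
  "set gs \<subseteq> (SIGMA n : UNIV. carrier (G n)) \<Longrightarrow> map (Dom (deloop G)) gs = map fst gs"
  "set gs \<subseteq> (SIGMA n : UNIV. carrier (G n)) \<Longrightarrow> map (Cod (deloop G)) gs = map fst gs"
  by (auto dest!: subsetD)

lemma Comp_deloop:
  "p \<in> (SIGMA n : UNIV. carrier (G n)) \<Longrightarrow> q \<in> (SIGMA n : UNIV. carrier (G n)) \<Longrightarrow> fst p = fst q \<Longrightarrow>
    Comp (deloop G) (p, q) = (fst q, snd p \<otimes>\<^bsub>G (fst q)\<^esub> snd q)"
  by auto

lemma Bprj_simps [simp]:
  "omap (Bprj \<Lambda>) = (\<lambda>n. n)"
  "g \<in> carrier (grp \<Lambda> n) \<Longrightarrow> amap (Bprj \<Lambda>) (n, g) = (n, prm \<Lambda> n g)"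
  "g \<in> carrier (grp \<Lambda> n) \<Longrightarrow> prm_of (Bprj \<Lambda>) (n, g) = prm \<Lambda> n g"
  by (simp_all add: Bprj_def prm_of_def)

lemma Bclub_simps [simp]:
  "ucat (Bclub \<Lambda>) = deloop (grp \<Lambda>)"
  "prj (Bclub \<Lambda>) = Bprj \<Lambda>"
  "unt (Bclub \<Lambda>) = 1"
  "(n, ks) \<in> circ_obj (deloop (grp \<Lambda>)) (Bprj \<Lambda>) \<Longrightarrow> omap (mlt (Bclub \<Lambda>)) (n, ks) = sum_list ks"
  "((n, f), gs) \<in> circ_arr (deloop (grp \<Lambda>)) (Bprj \<Lambda>) \<Longrightarrow> amap (mlt (Bclub \<Lambda>)) ((n, f), gs) =
    (sum_list (map fst gs), opmu \<Lambda> (map fst gs) (f, map snd gs))"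
  by (simp_all add: Bclub_def)

context operad
begin

lemma opmu_closed:
  "x \<in> ops P (length ks) \<Longrightarrow> ys \<in> listset (map (ops P) ks) \<Longrightarrow> opmu P ks (x, ys) \<in> ops P (sum_list ks)"
  using opmu_type[of ks] by auto

end

context action_operad
begin

sublocale G: group "grp \<Lambda> n" for n
  by (fact group_grp)

declare carrier_grp [simp]

lemma prm_permutes: "x \<in> ops \<Lambda> n \<Longrightarrow> prm \<Lambda> n x permutes {1..n}"
  using prm_hom[of n] by (auto simp: hom_def sym_group_carrier)

lemma prm_mult:
  "x \<in> ops \<Lambda> n \<Longrightarrow> y \<in> ops \<Lambda> n \<Longrightarrow> prm \<Lambda> n (x \<otimes>\<^bsub>grp \<Lambda> n\<^esub> y) = prm \<Lambda> n x \<circ> prm \<Lambda> n y"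
  using prm_hom[of n] by (auto simp: hom_def sym_group_mult)

lemma prm_one: "prm \<Lambda> n \<one>\<^bsub>grp \<Lambda> n\<^esub> = id"
  using prm_hom[of n] group_hom.hom_one[of "grp \<Lambda> n" "sym_group n" "prm \<Lambda> n"]
  by (simp add: group_hom_def group_hom_axioms_def G.is_group sym_group_is_group sym_group_one)

lemma prm_opmu:
  "x \<in> ops \<Lambda> (length ks) \<Longrightarrow> ys \<in> listset (map (ops \<Lambda>) ks) \<Longrightarrow>
    prm \<Lambda> (sum_list ks) (opmu \<Lambda> ks (x, ys)) = opmu symop ks (prm \<Lambda> (length ks) x, map2 (prm \<Lambda>) ks ys)"
  using prm_operad_map by (simp add: operad_map_def)

text \<open>Eckmann--Hilton: on \<open>ops \<Lambda> 1\<close> the group multiplication and \<open>opmu\<close> interchange.\<close>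

lemma opid_eq_one: "opid \<Lambda> = \<one>\<^bsub>grp \<Lambda> 1\<^esub>"
proof -
  let ?e = "\<one>\<^bsub>grp \<Lambda> 1\<^esub>"
  have e: "?e \<in> ops \<Lambda> 1"
    using G.one_closed[of 1] by simp
  \<comment> \<open>The unit is its own square. Its two copies are rewritten by the left and the
    right unit law of the operad, so that interchange multiplies \<open>opid\<close> with
    \<open>?e\<close> in each slot.\<close>
  have "?e = opmu \<Lambda> [1] (opid \<Lambda>, [?e]) \<otimes>\<^bsub>grp \<Lambda> 1\<^esub> opmu \<Lambda> [1] (?e, [opid \<Lambda>])"
    using e opmu_unit_left[of ?e 1] opmu_unit_right[of ?e 1] by simp
  also have "\<dots> = opmu \<Lambda> [1] (opid \<Lambda>, [opid \<Lambda>])"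
    using interchange[of ?e "[1]" "opid \<Lambda>" "[opid \<Lambda>]" "[?e]"] e opid_type
    by (simp add: prm_one inv_id set_Cons_def)
  also have "\<dots> = opid \<Lambda>"
    using opmu_unit_left opid_type by simp
  finally show ?thesis by simp
qed

text \<open>Interchange shows that the left side equals its own square, and in a group only the unit
  does. This is preservation of identities by \<open>m\<close>.\<close>

lemma opmu_ones: "opmu \<Lambda> ks (\<one>\<^bsub>grp \<Lambda> (length ks)\<^esub>, map (\<lambda>k. \<one>\<^bsub>grp \<Lambda> k\<^esub>) ks) = \<one>\<^bsub>grp \<Lambda> (sum_list ks)\<^esub>"
proof -
  let ?e = "\<one>\<^bsub>grp \<Lambda> (length ks)\<^esub>" and ?es = "map (\<lambda>k. \<one>\<^bsub>grp \<Lambda> k\<^esub>) ks"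
  have e: "?e \<in> ops \<Lambda> (length ks)" "?es \<in> listset (map (ops \<Lambda>) ks)"
    using G.one_closed by (auto simp: in_listset_ops)
  have es: "map (\<lambda>(k, f', f). f' \<otimes>\<^bsub>grp \<Lambda> k\<^esub> f) (zip ks (zip ?es ?es)) = ?es"
    using G.one_closed by (intro nth_equalityI) auto
  have "opmu \<Lambda> ks (?e, ?es) \<otimes>\<^bsub>grp \<Lambda> (sum_list ks)\<^esub> opmu \<Lambda> ks (?e, ?es) = opmu \<Lambda> ks (?e, ?es)"
    using interchange[of ?e ks ?e ?es ?es] e es by (simp add: prm_one inv_id)
  then show ?thesis
    using opmu_closed[OF e] G.l_cancel_one' by (metis carrier_grp)
qed

lemma category_deloop_grp: "category (deloop (grp \<Lambda>))"
  by (simp add: category_deloop G.is_group)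

sublocale B: collection "deloop (grp \<Lambda>)" "Bprj \<Lambda>"
proof (unfold collection_def is_functor_def is_functor_axioms_def, intro conjI allI impI)
  show "category (deloop (grp \<Lambda>))" "category BSigma"
    by (simp_all add: category_deloop G.is_group sym_group_is_group)
  show "omap (Bprj \<Lambda>) \<in> Obj (deloop (grp \<Lambda>)) \<rightarrow>\<^sub>E Obj BSigma"
    by simp
  show "amap (Bprj \<Lambda>) \<in> Arr (deloop (grp \<Lambda>)) \<rightarrow>\<^sub>E Arr BSigma"
    using prm_permutes by (auto simp: Bprj_def sym_group_carrier)
  show "amap (Bprj \<Lambda>) f \<in> Hom BSigma
      (omap (Bprj \<Lambda>) (Dom (deloop (grp \<Lambda>)) f)) (omap (Bprj \<Lambda>) (Cod (deloop (grp \<Lambda>)) f))"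
    if "f \<in> Arr (deloop (grp \<Lambda>))" for f
    using that prm_permutes by (auto simp: Hom_def sym_group_carrier)
  show "amap (Bprj \<Lambda>) (Ident (deloop (grp \<Lambda>)) x) = Ident BSigma (omap (Bprj \<Lambda>) x)" for x
    using G.one_closed by (simp add: prm_one sym_group_one)
  show "amap (Bprj \<Lambda>) (Comp (deloop (grp \<Lambda>)) (g, f)) =
      Comp BSigma (amap (Bprj \<Lambda>) g, amap (Bprj \<Lambda>) f)"
    if "(g, f) \<in> composable (deloop (grp \<Lambda>))" for g f
    using that G.m_closed prm_permutes
    by (auto simp: composable_def prm_mult sym_group_mult sym_group_carrier)
qed

text \<open>\<open>interchange\<close> in the language of \<open>circ\<close>. The tagged arrows
  have to be split into arities and operations, and composability forces the arities of
  \<open>gs'\<close> to be those of \<open>gs\<close> permuted by the inverse of \<pi>(f).\<close>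

lemma Bclub_mlt_Comp:
  assumes "(((n', f'), gs'), ((n, f), gs)) \<in> composable (circ (deloop (grp \<Lambda>)) (Bprj \<Lambda>))"
  shows "amap (mlt (Bclub \<Lambda>)) (Comp (circ (deloop (grp \<Lambda>)) (Bprj \<Lambda>)) (((n', f'), gs'), ((n, f), gs))) =
    Comp (deloop (grp \<Lambda>)) (amap (mlt (Bclub \<Lambda>)) ((n', f'), gs'), amap (mlt (Bclub \<Lambda>)) ((n, f), gs))"
proof -
  note c = assms[unfolded B.composable_circ prod.case]
  let ?ks = "map fst gs" and ?\<sigma> = "prm \<Lambda> n f"
  have f: "f \<in> ops \<Lambda> n" "f' \<in> ops \<Lambda> n" "n' = n"
    and len: "length gs = n" "length gs' = n"
    and gs: "set gs \<subseteq> (SIGMA n : UNIV. carrier (grp \<Lambda> n))" "set gs' \<subseteq> (SIGMA n : UNIV. carrier (grp \<Lambda> n))"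
    using c by auto
  have \<sigma>: "?\<sigma> permutes {1..n}"
    using f prm_permutes by auto
  have sel: "set (select ?\<sigma> gs') \<subseteq> (SIGMA n : UNIV. carrier (grp \<Lambda> n))"
    using set_select[of ?\<sigma> gs'] \<sigma> len gs(2) by auto
  have "map (Dom (deloop (grp \<Lambda>))) (select ?\<sigma> gs') = map (Cod (deloop (grp \<Lambda>))) gs"
    using c f by simp
  then have fst_eq: "map fst (select ?\<sigma> gs') = ?ks"
    using map_Dom_deloop(1)[OF sel] map_Dom_deloop(2)[OF gs(1)] by simp
  \<comment> \<open>Permuting back yields the arity list that \<open>interchange\<close> prescribes
    for the outer operations.\<close>
  then have ks': "map fst gs' = select (inv' ?\<sigma>) ?ks"
    using \<sigma> len by (metis length_map select_inverse(2) select_map)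
  have sum: "sum_list (map fst gs') = sum_list ?ks"
    unfolding ks' using \<sigma> len by (simp add: sum_list_select permutes_inv)
  let ?hs = "map (Comp (deloop (grp \<Lambda>))) (zip (select ?\<sigma> gs') gs)"
  have "?hs ! i = (fst (gs ! i), snd (select ?\<sigma> gs' ! i) \<otimes>\<^bsub>grp \<Lambda> (fst (gs ! i))\<^esub> snd (gs ! i))"
    if "i < n" for i
  proof -
    have "select ?\<sigma> gs' ! i \<in> (SIGMA n : UNIV. carrier (grp \<Lambda> n))"
      "gs ! i \<in> (SIGMA n : UNIV. carrier (grp \<Lambda> n))"
      using sel gs(1) len that by (metis length_select nth_mem subsetD)+
    moreover have "fst (select ?\<sigma> gs' ! i) = fst (gs ! i)"
      using arg_cong[OF fst_eq, of "\<lambda>xs. xs ! i"] that len by simp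
    moreover have "?hs ! i = Comp (deloop (grp \<Lambda>)) (select ?\<sigma> gs' ! i, gs ! i)"
      using that len by simp
    ultimately show ?thesis
      using Comp_deloop by metis
  qed
  then have hs: "map fst ?hs = ?ks" "map snd ?hs =
      map (\<lambda>(k, f', f). f' \<otimes>\<^bsub>grp \<Lambda> k\<^esub> f) (zip ?ks (zip (select ?\<sigma> (map snd gs')) (map snd gs)))"
    using len \<sigma> by (auto simp: select_map intro!: nth_equalityI)
  have fs: "map snd gs \<in> listset (map (ops \<Lambda>) ?ks)" "map snd gs' \<in> listset (map (ops \<Lambda>) (map fst gs'))"
    using map_snd_in_listset[of _ "ops \<Lambda>"] gs by (simp_all del: map_map)
  have eq: "opmu \<Lambda> (map fst gs') (f', map snd gs') \<otimes>\<^bsub>grp \<Lambda> (sum_list ?ks)\<^esub> opmu \<Lambda> ?ks (f, map snd gs) =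
      opmu \<Lambda> ?ks (f' \<otimes>\<^bsub>grp \<Lambda> n\<^esub> f, map snd ?hs)"
    using interchange[of f ?ks f' "map snd gs" "map snd gs'"] f len fs unfolding hs(2) by (simp add: ks')
  have "opmu \<Lambda> (map fst gs') (f', map snd gs') \<in> ops \<Lambda> (sum_list ?ks)"
    "opmu \<Lambda> ?ks (f, map snd gs) \<in> ops \<Lambda> (sum_list ?ks)"
    using opmu_closed[OF _ fs(1), of f] opmu_closed[OF _ fs(2), of f'] f len sum by auto
  then have "Comp (deloop (grp \<Lambda>)) (amap (mlt (Bclub \<Lambda>)) ((n', f'), gs'), amap (mlt (Bclub \<Lambda>)) ((n, f), gs)) =
      (sum_list ?ks, opmu \<Lambda> ?ks (f' \<otimes>\<^bsub>grp \<Lambda> n\<^esub> f, map snd ?hs))"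
    using f len gs sum eq by simp
  moreover have "((n, f' \<otimes>\<^bsub>grp \<Lambda> n\<^esub> f), ?hs) \<in> circ_arr (deloop (grp \<Lambda>)) (Bprj \<Lambda>)"
    using B.Comp_circ_closed[OF assms] f
    unfolding B.Comp_circ_composable[OF assms] by (simp add: Hom_def del: mem_circ_arr)
  ultimately show ?thesis
    using f hs(1) unfolding B.Comp_circ_composable[OF assms] by (simp del: mem_circ_arr map_map)
qed

text \<open>Elimination rule that turns an arrow of \<open>circ\<close> into arguments of
  \<open>opmu\<close>, with their typing and the resulting value of \<open>m\<close>, so that
  arguments about \<open>m\<close> can start from operad data.\<close>

lemma Bclub_mlt_arr:
  assumes "(p, gs) \<in> circ_arr (deloop (grp \<Lambda>)) (Bprj \<Lambda>)"
  obtains n f where "p = (n, f)" "f \<in> ops \<Lambda> n" "length gs = n"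
    "map snd gs \<in> listset (map (ops \<Lambda>) (map fst gs))"
    "opmu \<Lambda> (map fst gs) (f, map snd gs) \<in> ops \<Lambda> (sum_list (map fst gs))"
    "amap (mlt (Bclub \<Lambda>)) (p, gs) = (sum_list (map fst gs), opmu \<Lambda> (map fst gs) (f, map snd gs))"
proof -
  obtain n f where p: "p = (n, f)" by force
  have f: "f \<in> ops \<Lambda> n" "length gs = n" "set gs \<subseteq> (SIGMA n : UNIV. ops \<Lambda> n)"
    using assms by (auto simp: p)
  note gs = map_snd_in_listset[OF f(3)]
  show ?thesis
    using that[OF p f(1,2) gs opmu_closed[OF _ gs]] f(1,2) assms p by simp
qed

lemma Bclub_mlt_functor:
  "is_functor (circ (deloop (grp \<Lambda>)) (Bprj \<Lambda>)) (deloop (grp \<Lambda>)) (mlt (Bclub \<Lambda>))"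
proof (unfold is_functor_def is_functor_axioms_def, intro conjI allI impI)
  show "category (circ (deloop (grp \<Lambda>)) (Bprj \<Lambda>))" "category (deloop (grp \<Lambda>))"
    by (rule B.category_circ) (rule category_deloop_grp)
  show "omap (mlt (Bclub \<Lambda>)) \<in> Obj (circ (deloop (grp \<Lambda>)) (Bprj \<Lambda>)) \<rightarrow>\<^sub>E Obj (deloop (grp \<Lambda>))"
    by (simp add: Bclub_def)
  have "amap (mlt (Bclub \<Lambda>)) \<in> extensional (circ_arr (deloop (grp \<Lambda>)) (Bprj \<Lambda>))"
    by (simp add: Bclub_def)
  moreover have "amap (mlt (Bclub \<Lambda>)) (p, gs) \<in> Arr (deloop (grp \<Lambda>))"
    if "(p, gs) \<in> circ_arr (deloop (grp \<Lambda>)) (Bprj \<Lambda>)" for p gs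
    by (rule Bclub_mlt_arr[OF that]) simp
  ultimately show "amap (mlt (Bclub \<Lambda>)) \<in> Arr (circ (deloop (grp \<Lambda>)) (Bprj \<Lambda>)) \<rightarrow>\<^sub>E Arr (deloop (grp \<Lambda>))"
    by (auto simp: PiE_def simp del: mem_circ_arr)
next
  fix q assume "q \<in> Arr (circ (deloop (grp \<Lambda>)) (Bprj \<Lambda>))"
  then obtain p gs where q: "q = (p, gs)" "(p, gs) \<in> circ_arr (deloop (grp \<Lambda>)) (Bprj \<Lambda>)"
    by (cases q) auto
  obtain n f where f: "p = (n, f)" "f \<in> ops \<Lambda> n" "length gs = n"
    "opmu \<Lambda> (map fst gs) (f, map snd gs) \<in> ops \<Lambda> (sum_list (map fst gs))"
    "amap (mlt (Bclub \<Lambda>)) (p, gs) = (sum_list (map fst gs), opmu \<Lambda> (map fst gs) (f, map snd gs))"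
    using q(2) by (rule Bclub_mlt_arr)
  have gs: "map (Dom (deloop (grp \<Lambda>))) gs = map fst gs" "map (Cod (deloop (grp \<Lambda>))) gs = map fst gs"
    using q(2) by (auto intro!: map_Dom_deloop simp del: carrier_grp map_eq_conv)
  \<comment> \<open>The codomain lists the same arities in permuted order, so \<open>m\<close> sends
    source and target to the same number.\<close>
  have "sum_list (select (inv' (prm \<Lambda> n f)) (map fst gs)) = sum_list (map fst gs)"
    using f prm_permutes by (simp add: sum_list_select permutes_inv)
  then show "amap (mlt (Bclub \<Lambda>)) q \<in> Hom (deloop (grp \<Lambda>))
      (omap (mlt (Bclub \<Lambda>)) (Dom (circ (deloop (grp \<Lambda>)) (Bprj \<Lambda>)) q))
      (omap (mlt (Bclub \<Lambda>)) (Cod (circ (deloop (grp \<Lambda>)) (Bprj \<Lambda>)) q))"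
    using f gs q(2) by (simp add: q(1) Hom_def del: mem_circ_arr map_eq_conv)
next
  fix x assume "x \<in> Obj (circ (deloop (grp \<Lambda>)) (Bprj \<Lambda>))"
  then obtain ks where x: "x = (length ks, ks)"
    by (cases x) auto
  have "((length ks, \<one>\<^bsub>grp \<Lambda> (length ks)\<^esub>), map (\<lambda>k. (k, \<one>\<^bsub>grp \<Lambda> k\<^esub>)) ks) \<in> circ_arr (deloop (grp \<Lambda>)) (Bprj \<Lambda>)"
    using G.one_closed by auto
  moreover have I: "Ident (circ (deloop (grp \<Lambda>)) (Bprj \<Lambda>)) x =
      ((length ks, \<one>\<^bsub>grp \<Lambda> (length ks)\<^esub>), map (\<lambda>k. (k, \<one>\<^bsub>grp \<Lambda> k\<^esub>)) ks)"
    by (simp add: x)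
  ultimately show "amap (mlt (Bclub \<Lambda>)) (Ident (circ (deloop (grp \<Lambda>)) (Bprj \<Lambda>)) x) =
      Ident (deloop (grp \<Lambda>)) (omap (mlt (Bclub \<Lambda>)) x)"
    unfolding I using opmu_ones[of ks] by (simp add: x o_def del: mem_circ_arr)
next
  fix q p assume "(q, p) \<in> composable (circ (deloop (grp \<Lambda>)) (Bprj \<Lambda>))"
  then show "amap (mlt (Bclub \<Lambda>)) (Comp (circ (deloop (grp \<Lambda>)) (Bprj \<Lambda>)) (q, p)) =
      Comp (deloop (grp \<Lambda>)) (amap (mlt (Bclub \<Lambda>)) q, amap (mlt (Bclub \<Lambda>)) p)"
    using Bclub_mlt_Comp by (cases q; cases p) auto
qed

text \<open>On arrows of \<open>circ\<close> this is compatibility of \<open>prm\<close> with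
  \<open>opmu\<close>. As the functors are compared as records, arguments that are not arrows count
  too; there both sides are \<open>undefined\<close>.\<close>

lemma Bclub_mlt_over:
  "comp_funct (circ (deloop (grp \<Lambda>)) (Bprj \<Lambda>)) (Bprj \<Lambda>) (mlt (Bclub \<Lambda>)) = circ_prj (deloop (grp \<Lambda>)) (Bprj \<Lambda>)"
proof -
  let ?A = "circ_arr (deloop (grp \<Lambda>)) (Bprj \<Lambda>)" and ?O = "circ_obj (deloop (grp \<Lambda>)) (Bprj \<Lambda>)"
  have "compose ?O (omap (Bprj \<Lambda>)) (omap (mlt (Bclub \<Lambda>))) = omap (circ_prj (deloop (grp \<Lambda>)) (Bprj \<Lambda>))"
    by (auto simp: compose_def circ_prj_def fun_eq_iff)
  moreover have "compose ?A (amap (Bprj \<Lambda>)) (amap (mlt (Bclub \<Lambda>))) = amap (circ_prj (deloop (grp \<Lambda>)) (Bprj \<Lambda>))"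
  proof
    fix q
    show "compose ?A (amap (Bprj \<Lambda>)) (amap (mlt (Bclub \<Lambda>))) q = amap (circ_prj (deloop (grp \<Lambda>)) (Bprj \<Lambda>)) q"
    proof (cases "q \<in> ?A")
      case True
      obtain p gs where q: "q = (p, gs)"
        by (metis surj_pair)
      obtain n f where f: "p = (n, f)" "f \<in> ops \<Lambda> n" "length gs = n"
        and gs: "map snd gs \<in> listset (map (ops \<Lambda>) (map fst gs))"
        and op: "opmu \<Lambda> (map fst gs) (f, map snd gs) \<in> ops \<Lambda> (sum_list (map fst gs))"
        "amap (mlt (Bclub \<Lambda>)) (p, gs) = (sum_list (map fst gs), opmu \<Lambda> (map fst gs) (f, map snd gs))"
        using True unfolding q by (rule Bclub_mlt_arr)
      have arr: "\<forall>g \<in> set gs. g \<in> (SIGMA n : UNIV. carrier (grp \<Lambda> n))"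
        using True by (auto simp: q)
      then have ks: "map (Dom (deloop (grp \<Lambda>))) gs = map fst gs"
        by auto
      have "map (prm_of (Bprj \<Lambda>)) gs = map2 (prm \<Lambda>) (map fst gs) (map snd gs)"
        using arr by (intro nth_equalityI) (auto simp: prm_of_def Bprj_def case_prod_beta)
      then have "amap (circ_prj (deloop (grp \<Lambda>)) (Bprj \<Lambda>)) q =
          (sum_list (map fst gs), opmu symop (map fst gs) (prm \<Lambda> n f, map2 (prm \<Lambda>) (map fst gs) (map snd gs)))"
        using True f unfolding circ_prj_def by (simp add: q ks Let_def)
      also have "\<dots> = amap (Bprj \<Lambda>) (amap (mlt (Bclub \<Lambda>)) q)"
        using prm_opmu[of f "map fst gs", OF _ gs] f op by (simp add: q)
      finally show ?thesis
        using True by (simp add: compose_def)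
    qed (auto simp: compose_def circ_prj_def)
  qed
  ultimately show ?thesis
    by (simp add: comp_funct_def)
qed

lemma Bclub_assoc_arr:
  assumes "(f, gs) \<in> circ_arr (deloop (grp \<Lambda>)) (Bprj \<Lambda>)"
    and "list_all2 (\<lambda>g hs. (g, hs) \<in> circ_arr (deloop (grp \<Lambda>)) (Bprj \<Lambda>)) gs hss"
  shows "amap (mlt (Bclub \<Lambda>)) (amap (mlt (Bclub \<Lambda>)) (f, gs), concat hss) =
      amap (mlt (Bclub \<Lambda>)) (f, map (amap (mlt (Bclub \<Lambda>))) (zip gs hss))"
proof -
  let ?A = "circ_arr (deloop (grp \<Lambda>)) (Bprj \<Lambda>)" and ?m = "amap (mlt (Bclub \<Lambda>))"
  obtain n f0 where f: "f = (n, f0)" "f0 \<in> ops \<Lambda> n" "length gs = n"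
    "map snd gs \<in> listset (map (ops \<Lambda>) (map fst gs))"
    "opmu \<Lambda> (map fst gs) (f0, map snd gs) \<in> ops \<Lambda> (sum_list (map fst gs))"
    "?m (f, gs) = (sum_list (map fst gs), opmu \<Lambda> (map fst gs) (f0, map snd gs))"
    using assms(1) by (rule Bclub_mlt_arr)
  let ?lss = "map (map fst) hss" and ?zss = "map (map snd) hss"
  have len: "length hss = length gs"
    using assms(2) by (simp add: list_all2_lengthD)
  have hs: "snd (gs ! i) \<in> ops \<Lambda> (fst (gs ! i)) \<and> length (hss ! i) = fst (gs ! i) \<and>
      set (hss ! i) \<subseteq> (SIGMA n : UNIV. ops \<Lambda> n) \<and>
      map snd (hss ! i) \<in> listset (map (ops \<Lambda>) (map fst (hss ! i))) \<and>
      opmu \<Lambda> (map fst (hss ! i)) (snd (gs ! i), map snd (hss ! i)) \<in> ops \<Lambda> (sum_list (map fst (hss ! i))) \<and>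
      ?m (gs ! i, hss ! i) =
        (sum_list (map fst (hss ! i)), opmu \<Lambda> (map fst (hss ! i)) (snd (gs ! i), map snd (hss ! i)))"
    if "i < length gs" for i
  proof -
    have i: "(gs ! i, hss ! i) \<in> ?A"
      using assms(2) that by (simp add: list_all2_conv_all_nth del: mem_circ_arr)
    then show ?thesis
      by (rule Bclub_mlt_arr) (use i in simp)
  qed
  \<comment> \<open>Each operation in \<open>gs\<close> has as many inputs as its block in
    \<open>hss\<close> has entries. The arities of \<open>gs\<close> are thus the block lengths,
    which is the form in which \<open>opmu_assoc\<close> expects them.\<close>
  have lens: "map length ?lss = map fst gs"
    using hs len by (intro nth_equalityI) auto
  have "length (concat hss) = sum_list (map fst gs)"
    unfolding length_concat lens[symmetric] by (simp add: o_def)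
  moreover have "set (concat hss) \<subseteq> (SIGMA n : UNIV. ops \<Lambda> n)"
    using hs len unfolding set_concat in_set_conv_nth by (force simp: in_set_conv_nth)
  ultimately have "?m (?m (f, gs), concat hss) = (sum_list (concat ?lss),
      opmu \<Lambda> (concat ?lss) (opmu \<Lambda> (map length ?lss) (f0, map snd gs), concat ?zss))"
    unfolding f(6) lens map_concat[symmetric] using f(5) by simp
  also have "\<dots> = (sum_list (map sum_list ?lss), opmu \<Lambda> (map sum_list ?lss)
      (f0, map (\<lambda>(ls, y, zs). opmu \<Lambda> ls (y, zs)) (zip ?lss (zip (map snd gs) ?zss))))"
  proof -
    have "map snd gs \<in> listset (map (\<lambda>ls. ops \<Lambda> (length ls)) ?lss)"
      using hs len by (auto simp: in_listset_iff)
    moreover have "list_all2 (\<lambda>ls zs. zs \<in> listset (map (ops \<Lambda>) ls)) ?lss ?zss"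
      using hs len by (auto simp: list_all2_conv_all_nth)
    ultimately show ?thesis
      using opmu_assoc[of f0 ?lss "map snd gs" ?zss] f len by (simp add: sum_list_concat)
  qed
  also have "\<dots> = ?m (f, map ?m (zip gs hss))"
  proof -
    have m: "map fst (map ?m (zip gs hss)) = map sum_list ?lss"
      "map snd (map ?m (zip gs hss)) =
        map (\<lambda>(ls, y, zs). opmu \<Lambda> ls (y, zs)) (zip ?lss (zip (map snd gs) ?zss))"
      using hs len by (auto intro!: nth_equalityI)
    have "set (map ?m (zip gs hss)) \<subseteq> (SIGMA n : UNIV. ops \<Lambda> n)"
      using hs len by (auto simp: set_zip)
    then have "((n, f0), map ?m (zip gs hss)) \<in> ?A"
      using f len by simp
    then show ?thesis
      using m by (simp add: f(1) del: mem_circ_arr map_map)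
  qed
  finally show ?thesis .
qed

lemma club_Bclub: "club (Bclub \<Lambda>)"
proof (unfold club_def Bclub_simps, intro conjI allI impI)
  show "is_functor (deloop (grp \<Lambda>)) BSigma (Bprj \<Lambda>)"
    by (rule B.is_functor_axioms)
  show "is_functor (circ (deloop (grp \<Lambda>)) (Bprj \<Lambda>)) (deloop (grp \<Lambda>)) (mlt (Bclub \<Lambda>))"
    by (rule Bclub_mlt_functor)
  show "comp_funct (circ (deloop (grp \<Lambda>)) (Bprj \<Lambda>)) (Bprj \<Lambda>) (mlt (Bclub \<Lambda>)) =
      circ_prj (deloop (grp \<Lambda>)) (Bprj \<Lambda>)"
    by (rule Bclub_mlt_over)
  show "1 \<in> Obj (deloop (grp \<Lambda>))" "omap (Bprj \<Lambda>) 1 = 1"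
    by simp_all
  show "omap (mlt (Bclub \<Lambda>)) (1, [y]) = y" for y
    by simp
  \<comment> \<open>The unit laws of a club concern the identity arrow of the unit object, those of
    an operad concern \<open>opid\<close>; \<open>opid_eq_one\<close> identifies the two.\<close>
  show "amap (mlt (Bclub \<Lambda>)) (Ident (deloop (grp \<Lambda>)) 1, [g]) = g" if "g \<in> Arr (deloop (grp \<Lambda>))" for g
    using that G.one_closed[of 1] opmu_unit_left opid_eq_one by auto
  show "omap (mlt (Bclub \<Lambda>)) (x, replicate (omap (Bprj \<Lambda>) x) 1) = x" for x
    by (simp add: sum_list_replicate)
  show "amap (mlt (Bclub \<Lambda>)) (f, replicate (omap (Bprj \<Lambda>) (Dom (deloop (grp \<Lambda>)) f))
      (Ident (deloop (grp \<Lambda>)) 1)) = f" if "f \<in> Arr (deloop (grp \<Lambda>))" for f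
    using that G.one_closed[of 1] opmu_unit_right opid_eq_one
    by (auto simp: sum_list_replicate set_replicate_conv_if)
  show "omap (mlt (Bclub \<Lambda>)) (omap (mlt (Bclub \<Lambda>)) (x, ys), concat zss) =
      omap (mlt (Bclub \<Lambda>)) (x, map (omap (mlt (Bclub \<Lambda>))) (zip ys zss))"
    if "(x, ys) \<in> circ_obj (deloop (grp \<Lambda>)) (Bprj \<Lambda>)"
      "list_all2 (\<lambda>y zs. (y, zs) \<in> circ_obj (deloop (grp \<Lambda>)) (Bprj \<Lambda>)) ys zss" for x ys zss
  proof -
    \<comment> \<open>An object of B\<Lambda> is its own arity, so \<open>ys\<close> consists of the
      block lengths and both sides add up all entries of \<open>zss\<close>.\<close>
    have "map length zss = ys" "map (omap (mlt (Bclub \<Lambda>))) (zip ys zss) = map sum_list zss"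
      using that(2) by (auto simp: list_all2_conv_all_nth intro!: nth_equalityI)
    then show ?thesis
      using that(1) by (auto simp: sum_list_concat length_concat)
  qed
  show "amap (mlt (Bclub \<Lambda>)) (amap (mlt (Bclub \<Lambda>)) (f, gs), concat hss) =
      amap (mlt (Bclub \<Lambda>)) (f, map (amap (mlt (Bclub \<Lambda>))) (zip gs hss))"
    if "(f, gs) \<in> circ_arr (deloop (grp \<Lambda>)) (Bprj \<Lambda>)"
      "list_all2 (\<lambda>g hs. (g, hs) \<in> circ_arr (deloop (grp \<Lambda>)) (Bprj \<Lambda>)) gs hss" for f gs hss
    using that by (rule Bclub_assoc_arr)
qed

end

section \<open>The categories of action operads and of clubs\<close>

text \<open>\<open>AOp\<close> and \<open>Clubs\<close> have the same shape, with arrows bundled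
  with source and target so that domain and codomain can be read off. The source is an argument of
  \<open>cmp\<close> because composites of extensional maps are restricted to it.\<close>

lemma category_of_triples:
  fixes obj :: "'x \<Rightarrow> bool" and mor :: "'x \<Rightarrow> 'f \<Rightarrow> 'x \<Rightarrow> bool"
  defines "arrows \<equiv> {(A, f, B). mor A f B}"
  assumes mor_obj: "\<And>A f B. mor A f B \<Longrightarrow> obj A \<and> obj B"
    and mor_id: "\<And>A. obj A \<Longrightarrow> mor A (idn A) A"
    and mor_comp: "\<And>A f B g C. mor A f B \<Longrightarrow> mor B g C \<Longrightarrow> mor A (cmp A g f) C"
    and id_left: "\<And>A f B. mor A f B \<Longrightarrow> cmp A (idn B) f = f"
    and id_right: "\<And>A f B. mor A f B \<Longrightarrow> cmp A f (idn A) = f"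
    and comp_assoc: "\<And>A f B g C h D. mor A f B \<Longrightarrow> mor B g C \<Longrightarrow> mor C h D \<Longrightarrow>
      cmp A (cmp B h g) f = cmp A h (cmp A g f)"
  shows "category \<lparr>
    Obj = {A. obj A},
    Arr = arrows,
    Dom = (\<lambda>(A, f, B) \<in> arrows. A),
    Cod = (\<lambda>(A, f, B) \<in> arrows. B),
    Ident = (\<lambda>A \<in> {A. obj A}. (A, idn A, A)),
    Comp = (\<lambda>((B, g, C), (A, f, B')) \<in>
        {((B, g, C), (A, f, B')). (B, g, C) \<in> arrows \<and> (A, f, B') \<in> arrows \<and> B = B'}.
      (A, cmp A g f, C))\<rparr>" (is "category ?C")
proof (unfold category_def, intro conjI allI impI)
  show "Dom ?C \<in> Arr ?C \<rightarrow>\<^sub>E Obj ?C" "Cod ?C \<in> Arr ?C \<rightarrow>\<^sub>E Obj ?C"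
    using mor_obj by (auto simp: arrows_def)
  show "Ident ?C \<in> Obj ?C \<rightarrow>\<^sub>E Arr ?C"
    using mor_id by (auto simp: arrows_def)
  show "Comp ?C \<in> composable ?C \<rightarrow>\<^sub>E Arr ?C"
    using mor_comp by (auto simp: arrows_def composable_def extensional_def split: if_splits)
qed (auto simp: arrows_def composable_def Hom_def mor_id mor_comp id_left id_right comp_assoc dest: mor_obj)

section \<open>Morphisms of operads and of action operads\<close>

lemma operad_map_closed: "operad_map P Q f \<Longrightarrow> x \<in> ops P n \<Longrightarrow> f n x \<in> ops Q n"
  by (auto simp: operad_map_def)

lemma operad_map_list_closed:
  "operad_map P Q f \<Longrightarrow> ys \<in> listset (map (ops P) ks) \<Longrightarrow> map2 f ks ys \<in> listset (map (ops Q) ks)"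
  by (auto simp: in_listset_ops operad_map_closed)

lemma operad_map_compose:
  assumes "operad P" "operad_map P Q f" "operad_map Q R g"
  shows "operad_map P R (\<lambda>n. compose (ops P n) (g n) (f n))"
  unfolding operad_map_def
proof (intro conjI allI ballI)
  interpret P: operad P by fact
  show "compose (ops P n) (g n) (f n) \<in> ops P n \<rightarrow>\<^sub>E ops R n" for n
    using assms(2,3) by (auto simp: compose_def operad_map_closed)
  show "compose (ops P 1) (g 1) (f 1) (opid P) = opid R"
    using assms(2,3) P.opid_type by (simp add: compose_def operad_map_def)
  fix ks x ys assume x: "x \<in> ops P (length ks)" and ys: "ys \<in> listset (map (ops P) ks)"
  have "map2 (\<lambda>n. compose (ops P n) (g n) (f n)) ks ys = map2 g ks (map2 f ks ys)"
    using ys by (auto simp: in_listset_ops compose_def intro!: nth_equalityI)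
  then show "compose (ops P (sum_list ks)) (g (sum_list ks)) (f (sum_list ks)) (opmu P ks (x, ys)) =
      opmu R ks (compose (ops P (length ks)) (g (length ks)) (f (length ks)) x,
        map2 (\<lambda>n. compose (ops P n) (g n) (f n)) ks ys)"
    using x ys P.opmu_closed[OF x ys] operad_map_list_closed[OF assms(2) ys] operad_map_closed[OF assms(2) x]
      assms(2,3) by (simp add: compose_def operad_map_def)
qed

lemma aop_morphism_id:
  assumes "action_operad \<Lambda>"
  shows "aop_morphism \<Lambda> \<Lambda> (\<lambda>n. \<lambda>x \<in> ops \<Lambda> n. x)"
proof -
  interpret action_operad \<Lambda> by fact
  have "map2 (\<lambda>n. \<lambda>x \<in> ops \<Lambda> n. x) ks ys = ys" if "ys \<in> listset (map (ops \<Lambda>) ks)" for ks ys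
    using that by (auto simp: in_listset_ops intro!: nth_equalityI)
  then show ?thesis
    using assms opid_type opmu_closed G.m_closed
    by (auto simp: aop_morphism_def operad_map_def hom_def)
qed

lemma aop_morphism_compose:
  assumes "aop_morphism \<Lambda> \<Lambda>' f" "aop_morphism \<Lambda>' \<Lambda>'' g"
  shows "aop_morphism \<Lambda> \<Lambda>'' (\<lambda>n. compose (ops \<Lambda> n) (g n) (f n))"
proof -
  interpret action_operad \<Lambda>
    using assms by (simp add: aop_morphism_def)
  interpret \<Lambda>': action_operad \<Lambda>'
    using assms by (simp add: aop_morphism_def)
  interpret \<Lambda>'': action_operad \<Lambda>''
    using assms by (simp add: aop_morphism_def)
  have "operad_map \<Lambda> \<Lambda>'' (\<lambda>n. compose (ops \<Lambda> n) (g n) (f n))"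
    using operad_map_compose operad_axioms assms by (auto simp: aop_morphism_def)
  moreover have "compose (ops \<Lambda> n) (g n) (f n) \<in> hom (grp \<Lambda> n) (grp \<Lambda>'' n)" for n
    using assms G.m_closed[of _ n] by (auto simp: aop_morphism_def hom_def compose_def Pi_iff)
  moreover have "f n x \<in> ops \<Lambda>' n" if "x \<in> ops \<Lambda> n" for n x
    using that assms(1) operad_map_closed by (auto simp: aop_morphism_def)
  ultimately show ?thesis
    using assms by (simp add: aop_morphism_def compose_def)
qed

lemma operad_map_extensional: "operad_map P Q f \<Longrightarrow> x \<notin> ops P n \<Longrightarrow> f n x = undefined"
  by (auto simp: operad_map_def PiE_def extensional_def)

lemma category_AOp: "category AOp"
  unfolding AOp_def Let_def
proof (rule category_of_triples)
  fix A B C D :: "'a action_operad" and f g h :: "nat \<Rightarrow> 'a \<Rightarrow> 'a"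
  show "action_operad A \<Longrightarrow> aop_morphism A A (\<lambda>n. \<lambda>x \<in> ops A n. x)"
    by (rule aop_morphism_id)
  show "aop_morphism A B f \<Longrightarrow> action_operad A \<and> action_operad B"
    by (simp add: aop_morphism_def)
  show "aop_morphism A B f \<Longrightarrow> aop_morphism B C g \<Longrightarrow> aop_morphism A C (\<lambda>n. compose (ops A n) (g n) (f n))"
    by (rule aop_morphism_compose)
  show "aop_morphism A B f \<Longrightarrow> (\<lambda>n. compose (ops A n) (\<lambda>x \<in> ops B n. x) (f n)) = f"
    by (auto simp: aop_morphism_def operad_map_def PiE_def Id_compose)
  show "aop_morphism A B f \<Longrightarrow> (\<lambda>n. compose (ops A n) (f n) (\<lambda>x \<in> ops A n. x)) = f"
    by (auto simp: aop_morphism_def compose_def fun_eq_iff operad_map_extensional)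
  show "aop_morphism A B f \<Longrightarrow> aop_morphism B C g \<Longrightarrow> aop_morphism C D h \<Longrightarrow>
      (\<lambda>n. compose (ops A n) (compose (ops B n) (h n) (g n)) (f n)) =
      (\<lambda>n. compose (ops A n) (h n) (compose (ops A n) (g n) (f n)))"
    by (auto simp: aop_morphism_def compose_def fun_eq_iff operad_map_closed)
qed

section \<open>Morphisms of clubs\<close>

context club
begin

sublocale collection "ucat K" "prj K"
  unfolding collection_def by (fact prj_functor)

sublocale mlt: is_functor "circ (ucat K) (prj K)" "ucat K" "mlt K"
  by (fact mlt_functor)

end

lemma club_morphism_over:
  assumes "club_morphism K L F"
  shows "x \<in> Obj (ucat K) \<Longrightarrow> omap (prj L) (omap F x) = omap (prj K) x"
    and "f \<in> Arr (ucat K) \<Longrightarrow> amap (prj L) (amap F f) = amap (prj K) f"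
proof -
  have eq: "comp_funct (ucat K) (prj L) F = prj K"
    using assms by (simp add: club_morphism_def)
  show "x \<in> Obj (ucat K) \<Longrightarrow> omap (prj L) (omap F x) = omap (prj K) x"
    "f \<in> Arr (ucat K) \<Longrightarrow> amap (prj L) (amap F f) = amap (prj K) f"
    unfolding eq[symmetric] by (simp_all add: comp_funct_def compose_def)
qed

text \<open>A functor over B\<Sigma> preserves arities, so the lists keep the right length and
  \<open>F\<close> acts on the composite collections.\<close>

lemma club_morphism_circ:
  assumes "club_morphism K L F"
  shows "(x, ys) \<in> circ_obj (ucat K) (prj K) \<Longrightarrow> (omap F x, map (omap F) ys) \<in> circ_obj (ucat L) (prj L)"
    and "(f, gs) \<in> circ_arr (ucat K) (prj K) \<Longrightarrow> (amap F f, map (amap F) gs) \<in> circ_arr (ucat L) (prj L)"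
proof -
  interpret is_functor "ucat K" "ucat L" F
    using assms by (simp add: club_morphism_def)
  show "(x, ys) \<in> circ_obj (ucat K) (prj K) \<Longrightarrow> (omap F x, map (omap F) ys) \<in> circ_obj (ucat L) (prj L)"
    "(f, gs) \<in> circ_arr (ucat K) (prj K) \<Longrightarrow> (amap F f, map (amap F) gs) \<in> circ_arr (ucat L) (prj L)"
    by (auto simp: club_morphism_over[OF assms] subset_iff)
qed

lemma map_restrict_id: "set xs \<subseteq> A \<Longrightarrow> map (\<lambda>x \<in> A. x) xs = xs"
  by (intro map_idI) auto

lemma club_morphism_id:
  assumes "club K"
  shows "club_morphism K K (id_funct (ucat K))"
proof -
  interpret club K by fact
  have "omap (mlt K) (x, ys) \<in> Obj (ucat K)" if "(x, ys) \<in> circ_obj (ucat K) (prj K)" for x ys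
    using mlt.omap_closed that by simp
  moreover have "amap (mlt K) (f, gs) \<in> Arr (ucat K)" if "(f, gs) \<in> circ_arr (ucat K) (prj K)" for f gs
    using mlt.amap_closed that by simp
  moreover have "comp_funct (ucat K) (prj K) (id_funct (ucat K)) = prj K"
    using comp_funct_id_funct[OF prj_functor] by simp
  moreover have "is_functor (ucat K) (ucat K) (id_funct (ucat K))"
    by (simp add: is_functor_id_funct source.category_axioms)
  ultimately show ?thesis
    using assms unt_obj by (auto simp: club_morphism_def id_funct_def map_restrict_id)
qed

lemma club_morphism_compose:
  assumes "club_morphism K L F" "club_morphism L M G"
  shows "club_morphism K M (comp_funct (ucat K) G F)"
proof -
  interpret K: club K
    using assms by (simp add: club_morphism_def)
  have F: "is_functor (ucat K) (ucat L) F" and G: "is_functor (ucat L) (ucat M) G"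
    using assms by (simp_all add: club_morphism_def)
  have obj: "omap (mlt K) (x, ys) \<in> Obj (ucat K)" "map (omap (comp_funct (ucat K) G F)) ys = map (omap G) (map (omap F) ys)"
    if "(x, ys) \<in> circ_obj (ucat K) (prj K)" for x ys
    using K.mlt.omap_closed that by (auto simp: comp_funct_def compose_def)
  have arr: "amap (mlt K) (f, gs) \<in> Arr (ucat K)" "map (amap (comp_funct (ucat K) G F)) gs = map (amap G) (map (amap F) gs)"
    if "(f, gs) \<in> circ_arr (ucat K) (prj K)" for f gs
    using K.mlt.amap_closed that by (auto simp: comp_funct_def compose_def)
  show ?thesis
    unfolding club_morphism_def
  proof (intro conjI ballI)
    show "club K" "club M"
      using assms by (simp_all add: club_morphism_def)
    show "is_functor (ucat K) (ucat M) (comp_funct (ucat K) G F)"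
      using F G by (rule is_functor_comp_funct)
    show "comp_funct (ucat K) (prj M) (comp_funct (ucat K) G F) = prj K"
      using assms by (simp add: club_morphism_def comp_funct_assoc[OF F, symmetric])
    show "omap (comp_funct (ucat K) G F) (unt K) = unt M"
      using assms K.unt_obj by (simp add: club_morphism_def comp_funct_def compose_def)
  next
    fix p assume "p \<in> circ_obj (ucat K) (prj K)"
    moreover obtain x ys where p: "p = (x, ys)" by force
    ultimately have xys: "(x, ys) \<in> circ_obj (ucat K) (prj K)" by simp
    then have "omap (comp_funct (ucat K) G F) (omap (mlt K) (x, ys)) =
        omap G (omap (mlt L) (omap F x, map (omap F) ys))"
      using obj assms(1) by (auto simp: comp_funct_def compose_def club_morphism_def simp del: mem_circ_obj)
    also have "\<dots> = omap (mlt M) (omap G (omap F x), map (omap G) (map (omap F) ys))"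
      using club_morphism_circ(1)[OF assms(1) xys] assms(2) by (auto simp: club_morphism_def simp del: mem_circ_obj)
    finally show "case p of (x, ys) \<Rightarrow> omap (comp_funct (ucat K) G F) (omap (mlt K) (x, ys)) =
        omap (mlt M) (omap (comp_funct (ucat K) G F) x, map (omap (comp_funct (ucat K) G F)) ys)"
      using xys obj(2)[OF xys] by (simp add: p comp_funct_def compose_def del: map_map)
  next
    fix p assume "p \<in> circ_arr (ucat K) (prj K)"
    moreover obtain f gs where p: "p = (f, gs)" by force
    ultimately have fgs: "(f, gs) \<in> circ_arr (ucat K) (prj K)" by simp
    then have "amap (comp_funct (ucat K) G F) (amap (mlt K) (f, gs)) =
        amap G (amap (mlt L) (amap F f, map (amap F) gs))"
      using arr assms(1) by (auto simp: comp_funct_def compose_def club_morphism_def simp del: mem_circ_arr)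
    also have "\<dots> = amap (mlt M) (amap G (amap F f), map (amap G) (map (amap F) gs))"
      using club_morphism_circ(2)[OF assms(1) fgs] assms(2) by (auto simp: club_morphism_def simp del: mem_circ_arr)
    finally show "case p of (f, gs) \<Rightarrow> amap (comp_funct (ucat K) G F) (amap (mlt K) (f, gs)) =
        amap (mlt M) (amap (comp_funct (ucat K) G F) f, map (amap (comp_funct (ucat K) G F)) gs)"
      using fgs arr(2)[OF fgs] by (simp add: p comp_funct_def compose_def del: map_map)
  qed
qed

lemma category_Clubs: "category Clubs"
  unfolding Clubs_def Let_def
proof (rule category_of_triples)
  fix K L M N :: "('o, 'm) club" and F G H :: "('o, 'm, 'o, 'm) funct"
  show "club_morphism K L F \<Longrightarrow> club K \<and> club L"
    by (simp add: club_morphism_def)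
  show "club K \<Longrightarrow> club_morphism K K (id_funct (ucat K))"
    by (rule club_morphism_id)
  show "club_morphism K L F \<Longrightarrow> club_morphism L M G \<Longrightarrow> club_morphism K M (comp_funct (ucat K) G F)"
    by (rule club_morphism_compose)
  show "club_morphism K L F \<Longrightarrow> comp_funct (ucat K) (id_funct (ucat L)) F = F"
    "club_morphism K L F \<Longrightarrow> comp_funct (ucat K) F (id_funct (ucat K)) = F"
    by (auto simp: club_morphism_def comp_funct_id_funct)
  show "club_morphism K L F \<Longrightarrow> club_morphism L M G \<Longrightarrow> club_morphism M N H \<Longrightarrow>
      comp_funct (ucat K) (comp_funct (ucat L) H G) F = comp_funct (ucat K) H (comp_funct (ucat K) G F)"
    by (auto simp: club_morphism_def intro: comp_funct_assoc)
qed

section \<open>The embedding of action operads into clubs\<close>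

lemma Bmor_simps [simp]:
  "omap (Bmor \<Lambda> f) = (\<lambda>n. n)"
  "g \<in> carrier (grp \<Lambda> n) \<Longrightarrow> amap (Bmor \<Lambda> f) (n, g) = (n, f n g)"
  by (simp_all add: Bmor_def)

text \<open>The homomorphism property gives functoriality, compatibility with \<pi> places the
  functor over B\<Sigma>, and the operad map equation is preservation of \<open>m\<close> on
  arrows.\<close>

lemma club_morphism_Bmor:
  assumes "aop_morphism \<Lambda> \<Lambda>' f"
  shows "club_morphism (Bclub \<Lambda>) (Bclub \<Lambda>') (Bmor \<Lambda> f)"
proof -
  interpret action_operad \<Lambda>
    using assms by (simp add: aop_morphism_def)
  interpret \<Lambda>': action_operad \<Lambda>'
    using assms by (simp add: aop_morphism_def)
  have f: "operad_map \<Lambda> \<Lambda>' f" and f_hom: "f n \<in> hom (grp \<Lambda> n) (grp \<Lambda>' n)" for n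
    using assms by (simp_all add: aop_morphism_def)
  have f_closed: "f n x \<in> ops \<Lambda>' n" if "x \<in> ops \<Lambda> n" for n x
    using f that by (rule operad_map_closed)
  have f_mult: "f n (x \<otimes>\<^bsub>grp \<Lambda> n\<^esub> y) = f n x \<otimes>\<^bsub>grp \<Lambda>' n\<^esub> f n y" if "x \<in> ops \<Lambda> n" "y \<in> ops \<Lambda> n" for n x y
    using f_hom that by (auto simp: hom_def)
  have f_one: "f n \<one>\<^bsub>grp \<Lambda> n\<^esub> = \<one>\<^bsub>grp \<Lambda>' n\<^esub>" for n
    using hom_one[OF f_hom] G.is_group \<Lambda>'.G.is_group by simp
  have prm_f: "prm \<Lambda>' n (f n x) = prm \<Lambda> n x" if "x \<in> ops \<Lambda> n" for n x
    using assms that by (simp add: aop_morphism_def)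
  have "is_functor (deloop (grp \<Lambda>)) (deloop (grp \<Lambda>')) (Bmor \<Lambda> f)"
  proof (unfold is_functor_def is_functor_axioms_def, intro conjI allI impI)
    show "amap (Bmor \<Lambda> f) \<in> Arr (deloop (grp \<Lambda>)) \<rightarrow>\<^sub>E Arr (deloop (grp \<Lambda>'))"
      by (auto simp: Bmor_def f_closed)
  qed (auto simp: category_deloop_grp \<Lambda>'.category_deloop_grp Hom_def composable_def
      f_closed f_mult f_one G.one_closed[simplified] G.m_closed[simplified])
  moreover have "comp_funct (deloop (grp \<Lambda>)) (Bprj \<Lambda>') (Bmor \<Lambda> f) = Bprj \<Lambda>"
    by (auto simp: comp_funct_def Bprj_def Bmor_def compose_def fun_eq_iff f_closed prm_f)
  moreover have "amap (Bmor \<Lambda> f) (amap (mlt (Bclub \<Lambda>)) (p, gs)) =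
      amap (mlt (Bclub \<Lambda>')) (amap (Bmor \<Lambda> f) p, map (amap (Bmor \<Lambda> f)) gs)"
    if pgs: "(p, gs) \<in> circ_arr (deloop (grp \<Lambda>)) (Bprj \<Lambda>)" for p gs
  proof -
    obtain n x where p: "p = (n, x)" "x \<in> ops \<Lambda> n" "length gs = n"
      and gs: "map snd gs \<in> listset (map (ops \<Lambda>) (map fst gs))"
      and op: "opmu \<Lambda> (map fst gs) (x, map snd gs) \<in> ops \<Lambda> (sum_list (map fst gs))"
      "amap (mlt (Bclub \<Lambda>)) (p, gs) = (sum_list (map fst gs), opmu \<Lambda> (map fst gs) (x, map snd gs))"
      using pgs by (rule Bclub_mlt_arr)
    have eq: "map (amap (Bmor \<Lambda> f)) gs = map (\<lambda>(n, g). (n, f n g)) gs"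
      using pgs by (auto simp: subset_iff)
    have "set (map (\<lambda>(n, g). (n, f n g)) gs) \<subseteq> (SIGMA n : UNIV. ops \<Lambda>' n)"
      using pgs by (auto simp: subset_iff f_closed)
    moreover have "map fst (map (\<lambda>(n, g). (n, f n g)) gs) = map fst gs"
      "map snd (map (\<lambda>(n, g). (n, f n g)) gs) = map2 f (map fst gs) (map snd gs)"
      by (auto intro!: nth_equalityI simp: case_prod_beta)
    ultimately show ?thesis
      unfolding op(2) eq using f p gs op(1) unfolding operad_map_def by (simp add: f_closed del: map_map)
  qed
  moreover have "omap (mlt (Bclub \<Lambda>)) (n, ks) = omap (mlt (Bclub \<Lambda>')) (n, ks)"
    if "(n, ks) \<in> circ_obj (deloop (grp \<Lambda>)) (Bprj \<Lambda>)" for n ks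
    using that by simp
  ultimately show ?thesis
    unfolding club_morphism_def using club_Bclub \<Lambda>'.club_Bclub
    by (auto simp del: mem_circ_arr mem_circ_obj)
qed

text \<open>Lying over B\<Sigma>, the functor \<open>F\<close> fixes every number, so it only
  changes the second components of arrows, and these form \<open>f\<close>. A club morphism is
  required to preserve the unit as an object only; preservation of \<open>opid\<close> comes from
  functoriality, since \<open>opid\<close> is an identity arrow.\<close>

lemma Bmor_surjective:
  assumes "action_operad \<Lambda>" "action_operad \<Lambda>'" "club_morphism (Bclub \<Lambda>) (Bclub \<Lambda>') F"
  shows "\<exists>f. aop_morphism \<Lambda> \<Lambda>' f \<and> Bmor \<Lambda> f = F"
proof -
  interpret action_operad \<Lambda> by fact
  interpret \<Lambda>': action_operad \<Lambda>' by fact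
  interpret F: is_functor "deloop (grp \<Lambda>)" "deloop (grp \<Lambda>')" F
    using assms(3) by (simp add: club_morphism_def)
  have omap_F: "omap F n = n" for n
    using club_morphism_over(1)[OF assms(3), of n] by simp
  \<comment> \<open>The restriction makes each \<open>f n\<close> extensional, as an operad map must
    be.\<close>
  define f where "f n = (\<lambda>x \<in> ops \<Lambda> n. snd (amap F (n, x)))" for n
  have F_eq: "amap F (n, x) = (n, f n x)" and f_closed: "f n x \<in> ops \<Lambda>' n" if "x \<in> ops \<Lambda> n" for n x
    using that F.amap_closed[of "(n, x)"] omap_F by (auto simp: f_def)
  have "Bmor \<Lambda> f = F"
  proof -
    have "amap (Bmor \<Lambda> f) = amap F"
      using F.amap_type by (auto simp: Bmor_def fun_eq_iff F_eq PiE_def extensional_def)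
    moreover have "omap (Bmor \<Lambda> f) = omap F"
      by (auto simp: omap_F)
    ultimately show ?thesis by simp
  qed
  moreover have "prm \<Lambda>' n (f n x) = prm \<Lambda> n x" if "x \<in> ops \<Lambda> n" for n x
    using club_morphism_over(2)[OF assms(3), of "(n, x)"] that by (simp add: F_eq f_closed)
  moreover have "f n (x \<otimes>\<^bsub>grp \<Lambda> n\<^esub> y) = f n x \<otimes>\<^bsub>grp \<Lambda>' n\<^esub> f n y"
    if "x \<in> ops \<Lambda> n" "y \<in> ops \<Lambda> n" for n x y
    using F.amap_comp[of "(n, x)" "(n, y)"] that G.m_closed[of x n y] by (simp add: F_eq f_closed)
  moreover have "f 1 (opid \<Lambda>) = opid \<Lambda>'"
    using F.amap_Ident[of 1] opid_type F_eq[of "opid \<Lambda>" 1] omap_F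
    by (simp add: opid_eq_one \<Lambda>'.opid_eq_one)
  moreover have "f (sum_list ks) (opmu \<Lambda> ks (x, ys)) = opmu \<Lambda>' ks (f (length ks) x, map2 f ks ys)"
    if x: "x \<in> ops \<Lambda> (length ks)" and ys: "ys \<in> listset (map (ops \<Lambda>) ks)" for ks x ys
  proof -
    \<comment> \<open>Tagging each entry of \<open>ys\<close> with its arity turns the arguments of
      \<open>opmu\<close> into an arrow of \<open>circ\<close>, where preservation of
      \<open>m\<close> by \<open>F\<close> can be used.\<close>
    let ?gs = "zip ks ys" and ?hs = "map (amap F) (zip ks ys)"
    have len: "length ys = length ks"
      using ys by (simp add: in_listset_ops)
    have "set ?gs \<subseteq> (SIGMA n : UNIV. ops \<Lambda> n)"
      using ys by (auto simp: in_listset_ops set_zip)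
    then have gs: "((length ks, x), ?gs) \<in> circ_arr (deloop (grp \<Lambda>)) (Bprj \<Lambda>)"
      using x len by simp
    have "map fst ?hs = ks" "map snd ?hs = map2 f ks ys"
      using ys by (auto simp: in_listset_ops F_eq set_zip intro!: nth_equalityI)
    moreover have "((length ks, f (length ks) x), ?hs) \<in> circ_arr (deloop (grp \<Lambda>')) (Bprj \<Lambda>')"
      using club_morphism_circ(2)[OF assms(3), of "(length ks, x)" ?gs] gs F_eq[OF x]
      by (simp del: mem_circ_arr)
    moreover have "amap F (amap (mlt (Bclub \<Lambda>)) ((length ks, x), ?gs)) =
        amap (mlt (Bclub \<Lambda>')) (amap F (length ks, x), ?hs)"
      using assms(3) gs by (auto simp: club_morphism_def simp del: mem_circ_arr)
    ultimately show ?thesis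
      using gs len by (simp add: F_eq x opmu_closed[OF x ys] del: mem_circ_arr map_map)
  qed
  moreover have "f n x = undefined" if "x \<notin> ops \<Lambda> n" for n x
    using that by (simp add: f_def)
  ultimately show ?thesis
    using assms(1,2) f_closed
    by (intro exI[of _ f]) (auto simp: aop_morphism_def operad_map_def hom_def)
qed

text \<open>\<open>Bmor\<close> records the values on operations; off the operations both families
  are \<open>undefined\<close>.\<close>

lemma Bmor_injective:
  assumes "aop_morphism \<Lambda> \<Lambda>' f" "aop_morphism \<Lambda> \<Lambda>' g" "Bmor \<Lambda> f = Bmor \<Lambda> g"
  shows "f = g"
proof (intro ext)
  fix n x
  interpret action_operad \<Lambda>
    using assms by (simp add: aop_morphism_def)
  show "f n x = g n x"
  proof (cases "x \<in> ops \<Lambda> n")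
    case True
    then show ?thesis
      using arg_cong[OF assms(3), of "\<lambda>F. amap F (n, x)"] by simp
  next
    case False
    then show ?thesis
      using assms(1,2) unfolding aop_morphism_def by (metis operad_map_extensional)
  qed
qed

text \<open>On their domains the groups are read off from \<open>ucat\<close>, \<pi> from
  \<open>prj\<close> and \<mu> from \<open>mlt\<close>. Equality of records also needs agreement off
  the domains, where extensionality makes everything \<open>undefined\<close>; for the
  multiplication, a total function in the library record, this is
  \<open>mult_extensional\<close>.\<close>

lemma Bclub_injective:
  fixes \<Lambda> \<Lambda>' :: "'a action_operad"
  assumes "action_operad \<Lambda>" "action_operad \<Lambda>'" and eq: "Bclub \<Lambda> = Bclub \<Lambda>'"
  shows "\<Lambda> = \<Lambda>'"
proof -
  interpret action_operad \<Lambda> by fact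
  interpret \<Lambda>': action_operad \<Lambda>' by fact
  have ucat: "deloop (grp \<Lambda>) = deloop (grp \<Lambda>')" and prj: "Bprj \<Lambda> = Bprj \<Lambda>'"
    using arg_cong[OF eq, of ucat] arg_cong[OF eq, of prj] by simp_all
  have ops: "ops \<Lambda> n = ops \<Lambda>' n" for n
    using arg_cong[OF ucat, of Arr] by auto
  have one: "\<one>\<^bsub>grp \<Lambda> n\<^esub> = \<one>\<^bsub>grp \<Lambda>' n\<^esub>" for n
    using arg_cong[OF ucat, of "\<lambda>C. Ident C n"] by simp
  have mult: "mult (grp \<Lambda> n) x y = mult (grp \<Lambda>' n) x y" for n x y
  proof (cases "x \<in> ops \<Lambda> n \<and> y \<in> ops \<Lambda> n")
    case True
    then show ?thesis
      using arg_cong[OF ucat, of "\<lambda>C. Comp C ((n, x), (n, y))"] by (simp add: ops)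
  next
    case False
    then show ?thesis
      using extensional_arb[OF mult_extensional, of "(x, y)" n]
        extensional_arb[OF \<Lambda>'.mult_extensional, of "(x, y)" n] by (simp add: ops)
  qed
  have "grp \<Lambda> n = grp \<Lambda>' n" for n
    using ops one mult by (intro monoid.equality) (auto simp: fun_eq_iff)
  moreover have "prm \<Lambda> n x = prm \<Lambda>' n x" for n x
  proof (cases "x \<in> ops \<Lambda> n")
    case True
    then show ?thesis
      using arg_cong[OF prj, of "\<lambda>k. amap k (n, x)"] by (simp add: ops)
  next
    case False
    then show ?thesis
      using prm_operad_map \<Lambda>'.prm_operad_map by (simp add: operad_map_extensional ops)
  qed
  moreover have "opmu \<Lambda> ks p = opmu \<Lambda>' ks p" for ks p
  proof (cases "p \<in> ops \<Lambda> (length ks) \<times> listset (map (ops \<Lambda>) ks)")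
    case True
    then obtain x ys where p: "p = (x, ys)" "x \<in> ops \<Lambda> (length ks)" "ys \<in> listset (map (ops \<Lambda>) ks)"
      by auto
    have "set (zip ks ys) \<subseteq> (SIGMA n : UNIV. ops \<Lambda> n)" "length ys = length ks"
      using p(3) by (auto simp: in_listset_ops set_zip)
    then have "((length ks, x), zip ks ys) \<in> circ_arr (deloop (grp \<Lambda>)) (Bprj \<Lambda>)"
      "((length ks, x), zip ks ys) \<in> circ_arr (deloop (grp \<Lambda>')) (Bprj \<Lambda>')"
      using p(2) by (simp_all add: ops)
    then show ?thesis
      using arg_cong[OF eq, of "\<lambda>K. amap (mlt K) ((length ks, x), zip ks ys)"] \<open>length ys = length ks\<close>
      by (simp add: p(1) del: mem_circ_arr)
  next
    case False
    then have "opmu \<Lambda> ks p = undefined"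
      using opmu_type[of ks] by (rule PiE_arb[rotated])
    moreover have "opmu \<Lambda>' ks p = undefined"
      using \<Lambda>'.opmu_type[of ks] False unfolding ext[of "ops \<Lambda>", OF ops] by (rule PiE_arb)
    ultimately show ?thesis by simp
  qed
  moreover have "opid \<Lambda> = opid \<Lambda>'"
    using one by (simp add: opid_eq_one \<Lambda>'.opid_eq_one)
  ultimately show ?thesis
    using ops by (intro action_operad.equality) (auto simp: fun_eq_iff)
qed

section \<open>The functor from action operads to clubs\<close>

lemma AOp_simps [simp]:
  "Obj AOp = {\<Lambda>. action_operad \<Lambda>}"
  "Arr AOp = {(\<Lambda>, f, \<Lambda>'). aop_morphism \<Lambda> \<Lambda>' f}"
  "aop_morphism \<Lambda> \<Lambda>' f \<Longrightarrow> Dom AOp (\<Lambda>, f, \<Lambda>') = \<Lambda>"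
  "aop_morphism \<Lambda> \<Lambda>' f \<Longrightarrow> Cod AOp (\<Lambda>, f, \<Lambda>') = \<Lambda>'"
  "action_operad \<Lambda> \<Longrightarrow> Ident AOp \<Lambda> = (\<Lambda>, \<lambda>n. \<lambda>x \<in> ops \<Lambda> n. x, \<Lambda>)"
  "aop_morphism \<Lambda> \<Lambda>' f \<Longrightarrow> aop_morphism \<Lambda>' \<Lambda>'' g \<Longrightarrow>
    Comp AOp ((\<Lambda>', g, \<Lambda>''), (\<Lambda>, f, \<Lambda>')) = (\<Lambda>, \<lambda>n. compose (ops \<Lambda> n) (g n) (f n), \<Lambda>'')"
  by (simp_all add: AOp_def Let_def)

lemma Clubs_simps [simp]:
  "Obj Clubs = {K. club K}"
  "Arr Clubs = {(K, F, L). club_morphism K L F}"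
  "club_morphism K L F \<Longrightarrow> Dom Clubs (K, F, L) = K"
  "club_morphism K L F \<Longrightarrow> Cod Clubs (K, F, L) = L"
  "club K \<Longrightarrow> Ident Clubs K = (K, id_funct (ucat K), K)"
  "club_morphism K L F \<Longrightarrow> club_morphism L M G \<Longrightarrow>
    Comp Clubs ((L, G, M), (K, F, L)) = (K, comp_funct (ucat K) G F, M)"
  by (simp_all add: Clubs_def Let_def)

lemma B_functor_simps [simp]:
  "action_operad \<Lambda> \<Longrightarrow> omap B_functor \<Lambda> = Bclub \<Lambda>"
  "aop_morphism \<Lambda> \<Lambda>' f \<Longrightarrow> amap B_functor (\<Lambda>, f, \<Lambda>') = (Bclub \<Lambda>, Bmor \<Lambda> f, Bclub \<Lambda>')"
  by (simp_all add: B_functor_def)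

lemma Bmor_id:
  assumes "action_operad \<Lambda>"
  shows "Bmor \<Lambda> (\<lambda>n. \<lambda>x \<in> ops \<Lambda> n. x) = id_funct (deloop (grp \<Lambda>))"
proof -
  interpret action_operad \<Lambda> by fact
  show ?thesis
    by (auto simp: Bmor_def id_funct_def fun_eq_iff)
qed

lemma Bmor_compose:
  assumes "aop_morphism \<Lambda> \<Lambda>' f" "aop_morphism \<Lambda>' \<Lambda>'' g"
  shows "Bmor \<Lambda> (\<lambda>n. compose (ops \<Lambda> n) (g n) (f n)) = comp_funct (deloop (grp \<Lambda>)) (Bmor \<Lambda>' g) (Bmor \<Lambda> f)"
proof -
  interpret action_operad \<Lambda>
    using assms by (simp add: aop_morphism_def)
  interpret \<Lambda>': action_operad \<Lambda>'
    using assms by (simp add: aop_morphism_def)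
  have "f n x \<in> ops \<Lambda>' n" if "x \<in> ops \<Lambda> n" for n x
    using assms(1) operad_map_closed that by (auto simp: aop_morphism_def)
  then show ?thesis
    by (auto simp: Bmor_def comp_funct_def compose_def fun_eq_iff)
qed

lemma B_functor_full_faithful_embedding: "full_faithful_embedding AOp Clubs B_functor"
proof (unfold full_faithful_embedding_def full_faithful_embedding_axioms_def is_functor_def
    is_functor_axioms_def, intro conjI allI impI)
  show "category AOp" "category Clubs"
    by (rule category_AOp, rule category_Clubs)
  show "omap B_functor \<in> Obj AOp \<rightarrow>\<^sub>E Obj Clubs"
    by (auto simp: B_functor_def action_operad.club_Bclub)
  show "amap B_functor \<in> Arr AOp \<rightarrow>\<^sub>E Arr Clubs"
    by (auto simp: B_functor_def club_morphism_Bmor)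
  show "amap B_functor p \<in> Hom Clubs (omap B_functor (Dom AOp p)) (omap B_functor (Cod AOp p))"
    if "p \<in> Arr AOp" for p
  proof -
    obtain \<Lambda> f \<Lambda>' where p: "p = (\<Lambda>, f, \<Lambda>')" "aop_morphism \<Lambda> \<Lambda>' f"
      using \<open>p \<in> Arr AOp\<close> by auto
    then have "action_operad \<Lambda>" "action_operad \<Lambda>'"
      by (simp_all add: aop_morphism_def)
    then show ?thesis
      using p by (simp add: Hom_def club_morphism_Bmor)
  qed
  show "amap B_functor (Ident AOp \<Lambda>) = Ident Clubs (omap B_functor \<Lambda>)" if "\<Lambda> \<in> Obj AOp" for \<Lambda>
    using that by (simp add: aop_morphism_id action_operad.club_Bclub Bmor_id)
  show "amap B_functor (Comp AOp (q, p)) = Comp Clubs (amap B_functor q, amap B_functor p)"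
    if "(q, p) \<in> composable AOp" for q p
    using that by (auto simp: composable_def aop_morphism_compose club_morphism_Bmor Bmor_compose)
  show "\<exists>p \<in> Hom AOp \<Lambda> \<Lambda>'. amap B_functor p = h"
    if \<Lambda>: "\<Lambda> \<in> Obj AOp" "\<Lambda>' \<in> Obj AOp" and h: "h \<in> Hom Clubs (omap B_functor \<Lambda>) (omap B_functor \<Lambda>')" for \<Lambda> \<Lambda>' h
  proof -
    obtain F where F: "h = (Bclub \<Lambda>, F, Bclub \<Lambda>')" "club_morphism (Bclub \<Lambda>) (Bclub \<Lambda>') F"
      using \<Lambda> h by (auto simp: Hom_def)
    obtain f where f: "aop_morphism \<Lambda> \<Lambda>' f" "Bmor \<Lambda> f = F"
      using Bmor_surjective[OF _ _ F(2)] \<Lambda> by auto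
    then show ?thesis
      using F(1) by (intro bexI[of _ "(\<Lambda>, f, \<Lambda>')"]) (auto simp: Hom_def)
  qed
  show "inj_on (amap B_functor) (Hom AOp \<Lambda> \<Lambda>')" for \<Lambda> \<Lambda>'
    by (auto simp: inj_on_def Hom_def dest: Bmor_injective)
  show "inj_on (omap B_functor) (Obj AOp)"
    by (auto simp: inj_on_def intro: Bclub_injective)
qed

section \<open>The action operad of a groupoid club\<close>

locale groupoid_club = club K for K :: "('o, 'm) club" +
  assumes prj_bij: "bij_betw (omap (prj K)) (Obj (ucat K)) UNIV"
    and ucat_groupoid: "groupoid (ucat K)"
begin

definition pt :: "nat \<Rightarrow> 'o" where
  "pt = inv_into (Obj (ucat K)) (omap (prj K))"

definition deg :: "'m \<Rightarrow> nat" where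
  "deg f = omap (prj K) (Dom (ucat K) f)"

text \<open>The elements of \<Lambda>(n) are the arrows of \<open>K\<close> of degree n themselves,
  and all operations are those of \<open>K\<close> cut down to the right degrees. Restricting before
  \<open>curry\<close> makes the multiplication \<open>undefined\<close> off the carrier, as
  \<open>mult_extensional\<close> demands.\<close>

definition aop :: "'m action_operad" where
  "aop = \<lparr>
    ops = (\<lambda>n. {f \<in> Arr (ucat K). deg f = n}),
    opid = Ident (ucat K) (unt K),
    opmu = (\<lambda>ks. \<lambda>(f, gs) \<in> {f \<in> Arr (ucat K). deg f = length ks}
        \<times> listset (map (\<lambda>n. {f \<in> Arr (ucat K). deg f = n}) ks). amap (mlt K) (f, gs)),
    grp = (\<lambda>n. \<lparr>carrier = {f \<in> Arr (ucat K). deg f = n},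
      mult = curry (\<lambda>p \<in> {f \<in> Arr (ucat K). deg f = n} \<times> {f \<in> Arr (ucat K). deg f = n}. Comp (ucat K) p),
      one = Ident (ucat K) (pt n)\<rparr>),
    prm = (\<lambda>n. \<lambda>f \<in> {f \<in> Arr (ucat K). deg f = n}. prm_of (prj K) f)\<rparr>"

lemma pt [simp]: "pt n \<in> Obj (ucat K)" "omap (prj K) (pt n) = n"
proof -
  have "n \<in> omap (prj K) ` Obj (ucat K)"
    using prj_bij by (simp add: bij_betw_def)
  then show "pt n \<in> Obj (ucat K)" "omap (prj K) (pt n) = n"
    unfolding pt_def by (rule inv_into_into, rule f_inv_into_f)
qed

lemma pt_omap [simp]: "x \<in> Obj (ucat K) \<Longrightarrow> pt (omap (prj K) x) = x"
  using prj_bij by (simp add: pt_def bij_betw_def)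

lemma pt_eq_iff [simp]: "pt m = pt n \<longleftrightarrow> m = n"
  by (metis pt(2))

lemma Dom_eq: "f \<in> Arr (ucat K) \<Longrightarrow> Dom (ucat K) f = pt (deg f)"
  by (simp add: deg_def)

lemma Cod_eq: "f \<in> Arr (ucat K) \<Longrightarrow> Cod (ucat K) f = pt (deg f)"
  by (metis deg_def omap_Cod pt_omap source.Cod_closed)

lemma deg_Ident [simp]: "x \<in> Obj (ucat K) \<Longrightarrow> deg (Ident (ucat K) x) = omap (prj K) x"
  by (simp add: deg_def)

lemma Comp_deg [simp]:
  assumes "g \<in> Arr (ucat K)" "f \<in> Arr (ucat K)" "deg g = deg f"
  shows "Comp (ucat K) (g, f) \<in> Arr (ucat K)" "deg (Comp (ucat K) (g, f)) = deg f"
proof -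
  have "Dom (ucat K) g = Cod (ucat K) f"
    using assms by (simp add: Dom_eq Cod_eq)
  then show "Comp (ucat K) (g, f) \<in> Arr (ucat K)" "deg (Comp (ucat K) (g, f)) = deg f"
    using assms source.Comp_closed[of g f] by (simp_all add: deg_def)
qed

lemma mlt_obj:
  assumes "(x, ys) \<in> circ_obj (ucat K) (prj K)"
  shows "omap (mlt K) (x, ys) \<in> Obj (ucat K)"
    and "omap (prj K) (omap (mlt K) (x, ys)) = sum_list (map (omap (prj K)) ys)"
proof -
  show "omap (mlt K) (x, ys) \<in> Obj (ucat K)"
    using mlt.omap_closed assms by simp
  show "omap (prj K) (omap (mlt K) (x, ys)) = sum_list (map (omap (prj K)) ys)"
    using arg_cong[OF mlt_over, of "\<lambda>F. omap F (x, ys)"] assms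
    by (simp add: comp_funct_def compose_def circ_prj_def del: mem_circ_obj)
qed

text \<open>Evaluates \<open>mlt_over\<close> at an arrow. The first component in B\<Sigma> says
  that arities add up, the second that \<open>prm_of\<close> is compatible with the operad of
  symmetric groups.\<close>

lemma mlt_arr:
  assumes "(f, gs) \<in> circ_arr (ucat K) (prj K)"
  shows "amap (mlt K) (f, gs) \<in> Arr (ucat K)"
    and "deg (amap (mlt K) (f, gs)) = sum_list (map deg gs)"
    and "prm_of (prj K) (amap (mlt K) (f, gs)) =
      opmu symop (map deg gs) (prm_of (prj K) f, map (prm_of (prj K)) gs)"
proof -
  show mlt: "amap (mlt K) (f, gs) \<in> Arr (ucat K)"
    using mlt.amap_closed assms by simp
  have "amap (prj K) (amap (mlt K) (f, gs)) =
      (sum_list (map deg gs), opmu symop (map deg gs) (prm_of (prj K) f, map (prm_of (prj K)) gs))"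
    using arg_cong[OF mlt_over, of "\<lambda>F. amap F (f, gs)"] assms
    by (simp add: comp_funct_def compose_def circ_prj_def Let_def deg_def[abs_def] del: mem_circ_arr)
  then show "deg (amap (mlt K) (f, gs)) = sum_list (map deg gs)"
    "prm_of (prj K) (amap (mlt K) (f, gs)) =
      opmu symop (map deg gs) (prm_of (prj K) f, map (prm_of (prj K)) gs)"
    using amap_eq[OF mlt] by (simp_all add: deg_def)
qed

text \<open>Every arrow has a single degree, so the arity list is recovered from the list of
  arrows.\<close>

lemma in_listset_deg:
  "gs \<in> listset (map (\<lambda>n. {f \<in> Arr (ucat K). deg f = n}) ks) \<longleftrightarrow> set gs \<subseteq> Arr (ucat K) \<and> map deg gs = ks"
  by (auto simp: in_listset_ops list_eq_iff_nth_eq subset_iff) (metis in_set_conv_nth)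

lemma aop_simps [simp]:
  "ops aop = (\<lambda>n. {f \<in> Arr (ucat K). deg f = n})"
  "opid aop = Ident (ucat K) (unt K)"
  "carrier (grp aop n) = {f \<in> Arr (ucat K). deg f = n}"
  "\<one>\<^bsub>grp aop n\<^esub> = Ident (ucat K) (pt n)"
  "g \<in> Arr (ucat K) \<Longrightarrow> f \<in> Arr (ucat K) \<Longrightarrow> deg g = n \<Longrightarrow> deg f = n \<Longrightarrow>
    g \<otimes>\<^bsub>grp aop n\<^esub> f = Comp (ucat K) (g, f)"
  "f \<in> Arr (ucat K) \<Longrightarrow> deg f = n \<Longrightarrow> prm aop n f = prm_of (prj K) f"
  "f \<in> Arr (ucat K) \<Longrightarrow> deg f = length ks \<Longrightarrow> set gs \<subseteq> Arr (ucat K) \<Longrightarrow> map deg gs = ks \<Longrightarrow>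
    opmu aop ks (f, gs) = amap (mlt K) (f, gs)"
  using in_listset_deg[of gs ks] by (simp_all add: aop_def)

lemma mem_circ_arr_deg:
  "f \<in> Arr (ucat K) \<Longrightarrow> deg f = length gs \<Longrightarrow> set gs \<subseteq> Arr (ucat K) \<Longrightarrow> (f, gs) \<in> circ_arr (ucat K) (prj K)"
  by (simp add: deg_def)

text \<open>The laws are those of the club on arrows, which hold for members of
  \<open>circ_arr\<close>. The arity conditions in the operad laws place the given lists there,
  through \<open>mem_circ_arr_deg\<close>.\<close>

lemma operad_aop: "operad aop"
proof
  show "opid aop \<in> ops aop 1"
    using unt_obj prj_unt by simp
  show "opmu aop ks \<in> ops aop (length ks) \<times> listset (map (ops aop) ks) \<rightarrow>\<^sub>E ops aop (sum_list ks)" for ks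
  proof -
    have "opmu aop ks \<in> extensional (ops aop (length ks) \<times> listset (map (ops aop) ks))"
      by (auto simp: aop_def)
    moreover have "opmu aop ks (f, gs) \<in> ops aop (sum_list ks)"
      if "f \<in> ops aop (length ks)" "gs \<in> listset (map (ops aop) ks)" for f gs
      using that mlt_arr[OF mem_circ_arr_deg, of f gs] by (auto simp: in_listset_deg)
    ultimately show ?thesis
      by (auto simp: PiE_def simp del: aop_simps)
  qed
  show "opmu aop [n] (opid aop, [f]) = f" if "f \<in> ops aop n" for f n
    using that unt_obj prj_unt unit_left_arr by simp
  show "opmu aop (replicate n 1) (f, replicate n (opid aop)) = f" if "f \<in> ops aop n" for f n
    using that unt_obj prj_unt unit_right_arr[of f]
    by (simp add: set_replicate_conv_if flip: deg_def)
next
  fix f :: 'm and gs and hss :: "'m list list" and lss :: "nat list list"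
  assume f: "f \<in> ops aop (length lss)"
    and gs: "gs \<in> listset (map (\<lambda>ls. ops aop (length ls)) lss)"
    and hss: "list_all2 (\<lambda>ls hs. hs \<in> listset (map (ops aop) ls)) lss hss"
  have gs': "set gs \<subseteq> Arr (ucat K)" "map deg gs = map length lss"
    using gs in_listset_deg[of gs "map length lss"] by (simp_all add: o_def)
  \<comment> \<open>The nested arity lists are the degrees of the entries of \<open>hss\<close>, so
    they can be eliminated in favour of \<open>hss\<close>.\<close>
  have lss: "lss = map (map deg) hss" "\<forall>hs \<in> set hss. set hs \<subseteq> Arr (ucat K)"
  proof -
    have *: "length lss = length hss"
      "\<And>i. i < length hss \<Longrightarrow> set (hss ! i) \<subseteq> Arr (ucat K) \<and> map deg (hss ! i) = lss ! i"
      using hss by (auto simp: list_all2_conv_all_nth in_listset_deg)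
    then show "lss = map (map deg) hss"
      by (auto intro: nth_equalityI)
    show "\<forall>hs \<in> set hss. set hs \<subseteq> Arr (ucat K)"
      using *(2) by (metis in_set_conv_nth)
  qed
  have len: "length gs = length hss"
    using gs' lss(1) by (metis length_map)
  have fgs: "(f, gs) \<in> circ_arr (ucat K) (prj K)"
    using f gs' len lss(1) by (intro mem_circ_arr_deg) auto
  have ghs: "list_all2 (\<lambda>g hs. (g, hs) \<in> circ_arr (ucat K) (prj K)) gs hss"
    unfolding list_all2_conv_all_nth
  proof (intro conjI allI impI mem_circ_arr_deg)
    fix i assume i: "i < length gs"
    show "gs ! i \<in> Arr (ucat K)" "set (hss ! i) \<subseteq> Arr (ucat K)"
      using gs' lss(2) i len by (auto simp: subset_iff)
    show "deg (gs ! i) = length (hss ! i)"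
      using arg_cong[OF gs'(2), of "\<lambda>xs. xs ! i"] lss(1) i len by simp
  qed (rule len)
  have "opmu aop (concat lss) (opmu aop (map length lss) (f, gs), concat hss) =
      amap (mlt K) (amap (mlt K) (f, gs), concat hss)"
  proof -
    have "opmu aop (map length lss) (f, gs) = amap (mlt K) (f, gs)"
      using f gs' by simp
    moreover have "set (concat hss) \<subseteq> Arr (ucat K)" "map deg (concat hss) = concat lss"
      using lss by (auto simp: map_concat)
    ultimately show ?thesis
      using mlt_arr(1,2)[OF fgs] gs'(2) by (simp add: length_concat)
  qed
  also have "\<dots> = amap (mlt K) (f, map (amap (mlt K)) (zip gs hss))"
    by (rule assoc_arr[OF fgs ghs])
  also have "\<dots> = opmu aop (map sum_list lss) (f, map (amap (mlt K)) (zip gs hss))"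
  proof -
    let ?us = "map (amap (mlt K)) (zip gs hss)"
    have "set ?us \<subseteq> Arr (ucat K)" "map deg ?us = map sum_list lss"
      using ghs mlt_arr len by (auto simp: list_all2_conv_all_nth set_zip lss(1)
          simp del: mem_circ_arr intro!: nth_equalityI)
    then show ?thesis
      using f by (simp del: map_map)
  qed
  also have "map (amap (mlt K)) (zip gs hss) =
      map (\<lambda>(ls, g, hs). opmu aop ls (g, hs)) (zip lss (zip gs hss))"
  proof (rule nth_equalityI)
    fix i assume "i < length (map (amap (mlt K)) (zip gs hss))"
    then have i: "i < length hss" by simp
    have "opmu aop (lss ! i) (gs ! i, hss ! i) = amap (mlt K) (gs ! i, hss ! i)"
      using ghs i lss len by (simp add: list_all2_conv_all_nth deg_def)
    then show "map (amap (mlt K)) (zip gs hss) ! i =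
        map (\<lambda>(ls, g, hs). opmu aop ls (g, hs)) (zip lss (zip gs hss)) ! i"
      using i len lss(1) by simp
  qed (simp add: len lss(1))
  finally show "opmu aop (concat lss) (opmu aop (map length lss) (f, gs), concat hss) =
      opmu aop (map sum_list lss) (f, map (\<lambda>(ls, g, hs). opmu aop ls (g, hs)) (zip lss (zip gs hss)))" .
qed

text \<open>Invertibility of the arrows of \<open>K\<close> enters here, as the left inverses that
  \<open>groupI\<close> asks for.\<close>

lemma group_aop: "group (grp aop n)"
proof (rule groupI)
  fix f assume f: "f \<in> carrier (grp aop n)"
  show "\<one>\<^bsub>grp aop n\<^esub> \<otimes>\<^bsub>grp aop n\<^esub> f = f"
    using f source.Ident_left[of f] by (simp add: Cod_eq)
  obtain g where "g \<in> Hom (ucat K) (Cod (ucat K) f) (Dom (ucat K) f)"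
    "Comp (ucat K) (g, f) = Ident (ucat K) (Dom (ucat K) f)"
    using groupoid.inverses[OF ucat_groupoid, of f] f by auto
  then show "\<exists>g \<in> carrier (grp aop n). g \<otimes>\<^bsub>grp aop n\<^esub> f = \<one>\<^bsub>grp aop n\<^esub>"
    using f by (intro bexI[of _ g]) (auto simp: Hom_def deg_def)
next
  fix f g h
  assume "f \<in> carrier (grp aop n)" "g \<in> carrier (grp aop n)" "h \<in> carrier (grp aop n)"
  then show "f \<otimes>\<^bsub>grp aop n\<^esub> g \<otimes>\<^bsub>grp aop n\<^esub> h = f \<otimes>\<^bsub>grp aop n\<^esub> (g \<otimes>\<^bsub>grp aop n\<^esub> h)"
    by (simp add: source.assoc Dom_eq Cod_eq)
qed auto

lemma action_operad_aop: "action_operad aop"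
proof (unfold action_operad_def action_operad_axioms_def, intro conjI allI impI)
  show "operad aop"
    by (rule operad_aop)
  show "carrier (grp aop n) = ops aop n" for n
    by simp
  show "case_prod (mult (grp aop n)) \<in> extensional (ops aop n \<times> ops aop n)" for n
    by (simp add: aop_def)
  show "group (grp aop n)" for n
    by (rule group_aop)
  have prm: "prm_of (prj K) f permutes {1..n}" if "f \<in> Arr (ucat K)" "deg f = n" for f n
    using that prm_of_permutes by (auto simp: deg_def)
  have prm_ext: "prm aop n \<in> extensional (ops aop n)" for n
    by (simp add: aop_def)
  show "operad_map aop symop (prm aop)"
    unfolding operad_map_def
  proof (intro conjI allI ballI)
    show "prm aop n \<in> ops aop n \<rightarrow>\<^sub>E ops symop n" for n
      using prm_ext prm by (auto simp: PiE_def symop_def sym_group_carrier)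
    show "prm aop 1 (opid aop) = opid symop"
      using unt_obj prj_unt by (simp add: symop_def sym_group_one)
    fix ks f gs assume f: "f \<in> ops aop (length ks)" and gs: "gs \<in> listset (map (ops aop) ks)"
    have gs': "set gs \<subseteq> Arr (ucat K)" "map deg gs = ks" "length gs = length ks"
      using gs by (auto simp: in_listset_deg)
    have "map2 (prm aop) ks gs = map (prm_of (prj K)) gs"
      using gs' by (auto simp: subset_iff intro!: nth_equalityI)
    then show "prm aop (sum_list ks) (opmu aop ks (f, gs)) =
        opmu symop ks (prm aop (length ks) f, map2 (prm aop) ks gs)"
      using mlt_arr[OF mem_circ_arr_deg, of f gs] f gs' by simp
  qed
  show "prm aop n \<in> hom (grp aop n) (sym_group n)" for n
    using prm by (auto simp: hom_def sym_group_carrier sym_group_mult Dom_eq Cod_eq)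
next
  fix g ks g' fs fs'
  assume g: "g \<in> ops aop (length ks)" and g': "g' \<in> ops aop (length ks)"
    and fs: "fs \<in> listset (map (ops aop) ks)"
    and fs': "fs' \<in> listset (map (ops aop) (select (inv' (prm aop (length ks) g)) ks))"
  let ?\<sigma> = "prm_of (prj K) g"
  let ?ks' = "select (inv' ?\<sigma>) ks"
  have arr: "g \<in> Arr (ucat K)" "g' \<in> Arr (ucat K)" "deg g = length ks" "deg g' = length ks"
    using g g' by auto
  have \<sigma>: "?\<sigma> permutes {1..length ks}"
    using prm_of_permutes[OF arr(1)] arr(3) by (simp add: deg_def)
  have fs: "set fs \<subseteq> Arr (ucat K)" "map deg fs = ks" "length fs = length ks"
    using fs by (auto simp: in_listset_deg)
  have fs': "set fs' \<subseteq> Arr (ucat K)" "map deg fs' = ?ks'" "length fs' = length ks"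
    using fs' arr
    by (auto simp: in_listset_deg simp flip: length_map[of deg])
  have sel: "map deg (select ?\<sigma> fs') = ks" "set (select ?\<sigma> fs') \<subseteq> Arr (ucat K)"
    using \<sigma> fs' set_select[of ?\<sigma> fs'] by (auto simp: select_map[symmetric] select_inverse)
  \<comment> \<open>An object is determined by its arity through \<open>pt\<close>, and every arrow
    is an endomorphism. Agreement of degrees therefore already makes the arrows composable.\<close>
  have dom: "map (Dom (ucat K)) (select ?\<sigma> fs') = map (Cod (ucat K)) fs"
  proof -
    have "map (Dom (ucat K)) (select ?\<sigma> fs') = map pt (map deg (select ?\<sigma> fs'))"
      using sel(2) by (auto simp: Dom_eq)
    also have "\<dots> = map (Cod (ucat K)) fs"
      using fs(1) unfolding sel(1) fs(2)[symmetric] by (auto simp: Cod_eq)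
    finally show ?thesis .
  qed
  have circ: "(g', fs') \<in> circ_arr (ucat K) (prj K)" "(g, fs) \<in> circ_arr (ucat K) (prj K)"
    using arr fs fs' by (metis mem_circ_arr_deg)+
  then have c: "((g', fs'), (g, fs)) \<in> composable (circ (ucat K) (prj K))"
    unfolding composable_circ prod.case using dom Dom_eq[OF arr(2)] Cod_eq[OF arr(1)] arr(3,4) by metis
  let ?hs = "map (Comp (ucat K)) (zip (select ?\<sigma> fs') fs)"
  have map_deg: "map deg hs = map (omap (prj K)) (map (Dom (ucat K)) hs)" for hs
    by (simp add: deg_def)
  have hs: "set ?hs \<subseteq> Arr (ucat K)" "map deg ?hs = ks"
    using Dom_Cod_Comp_lists(1)[OF sel(2) fs(1) dom] fs(2)
    unfolding map_deg Dom_Cod_Comp_lists(2)[OF sel(2) fs(1) dom] by simp_all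
  have "opmu aop ?ks' (g', fs') \<otimes>\<^bsub>grp aop (sum_list ks)\<^esub> opmu aop ks (g, fs) =
      Comp (ucat K) (amap (mlt K) (g', fs'), amap (mlt K) (g, fs))"
    using arr fs fs' \<sigma> mlt_arr[OF circ(1)] mlt_arr[OF circ(2)]
    by (simp add: sum_list_select permutes_inv)
  also have "\<dots> = amap (mlt K) (Comp (ucat K) (g', g), ?hs)"
    using mlt.amap_Comp[OF c] unfolding Comp_circ_composable[OF c] by simp
  also have "\<dots> = opmu aop ks (g' \<otimes>\<^bsub>grp aop (length ks)\<^esub> g, ?hs)"
    using arr hs by simp
  \<comment> \<open>Both arrows at position i have degree \<open>ks ! i\<close>, so their composite
    in \<open>K\<close> is their product in the group with that index.\<close>
  also have "?hs = map (\<lambda>(k, f', f). f' \<otimes>\<^bsub>grp aop k\<^esub> f) (zip ks (zip (select ?\<sigma> fs') fs))"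
  proof (rule nth_equalityI)
    fix i assume "i < length ?hs"
    then have i: "i < length ks" using fs fs' by simp
    have "select ?\<sigma> fs' ! i \<in> Arr (ucat K)" "fs ! i \<in> Arr (ucat K)"
      using sel(2) fs(1) fs(3) fs'(3) i by (metis length_select nth_mem subsetD)+
    moreover have "deg (select ?\<sigma> fs' ! i) = ks ! i" "deg (fs ! i) = ks ! i"
      using sel(1) fs(2) fs(3) fs'(3) i by (metis length_select nth_map)+
    ultimately show "?hs ! i = map (\<lambda>(k, f', f). f' \<otimes>\<^bsub>grp aop k\<^esub> f) (zip ks (zip (select ?\<sigma> fs') fs)) ! i"
      using i fs(3) fs'(3) by (simp del: nth_select)
  qed (use fs fs' in simp)
  finally show "opmu aop (select (inv' (prm aop (length ks) g)) ks) (g', fs') \<otimes>\<^bsub>grp aop (sum_list ks)\<^esub>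
      opmu aop ks (g, fs) = opmu aop ks (g' \<otimes>\<^bsub>grp aop (length ks)\<^esub> g,
        map (\<lambda>(k, f', f). f' \<otimes>\<^bsub>grp aop k\<^esub> f) (zip ks (zip (select (prm aop (length ks) g) fs') fs)))"
    using arr by simp
qed

section \<open>The isomorphism between a club and the club of its action operad\<close>

sublocale aop: action_operad aop
  by (rule action_operad_aop)

text \<open>Together with \<open>from_B\<close> this adds and removes the arity tag on arrows; on
  objects the two are \<open>k\<close> and its inverse.\<close>

definition to_B :: "('o, 'm, nat, nat \<times> 'm) funct" where
  "to_B = \<lparr>omap = omap (prj K), amap = (\<lambda>f \<in> Arr (ucat K). (deg f, f))\<rparr>"

definition from_B :: "(nat, nat \<times> 'm, 'o, 'm) funct" where
  "from_B = \<lparr>omap = pt, amap = (\<lambda>(n, f) \<in> Arr (deloop (grp aop)). f)\<rparr>"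

lemma to_B_simps [simp]:
  "omap to_B = omap (prj K)"
  "f \<in> Arr (ucat K) \<Longrightarrow> amap to_B f = (deg f, f)"
  by (simp_all add: to_B_def)

lemma from_B_simps [simp]:
  "omap from_B = pt"
  "f \<in> Arr (ucat K) \<Longrightarrow> deg f = n \<Longrightarrow> amap from_B (n, f) = f"
  by (simp_all add: from_B_def)

lemma club_morphism_to_B: "club_morphism K (Bclub aop) to_B"
  unfolding club_morphism_def Bclub_simps
proof (intro conjI ballI)
  show "club K" "club (Bclub aop)"
    by (rule club_axioms, rule aop.club_Bclub)
  show "is_functor (ucat K) (deloop (grp aop)) to_B"
  proof (unfold is_functor_def is_functor_axioms_def, intro conjI allI impI)
    show "omap to_B \<in> Obj (ucat K) \<rightarrow>\<^sub>E Obj (deloop (grp aop))"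
      using omap_type by simp
    show "amap to_B \<in> Arr (ucat K) \<rightarrow>\<^sub>E Arr (deloop (grp aop))"
      by (auto simp: to_B_def)
  qed (auto simp: source.category_axioms aop.category_deloop_grp Hom_def composable_def Dom_eq Cod_eq)
  have "compose (Arr (ucat K)) (amap (Bprj aop)) (amap to_B) = amap (prj K)"
    using amap_type amap_eq by (auto simp: compose_def fun_eq_iff deg_def PiE_def extensional_def)
  moreover have "compose (Obj (ucat K)) (omap (Bprj aop)) (omap to_B) = omap (prj K)"
    using omap_type by (auto simp: compose_def fun_eq_iff PiE_def extensional_def)
  ultimately show "comp_funct (ucat K) (Bprj aop) to_B = prj K"
    by (simp add: comp_funct_def)
  show "omap to_B (unt K) = 1"
    by (simp add: prj_unt)
  show "case p of (x, ys) \<Rightarrow> omap to_B (omap (mlt K) (x, ys)) =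
      omap (mlt (Bclub aop)) (omap to_B x, map (omap to_B) ys)"
    if "p \<in> circ_obj (ucat K) (prj K)" for p
    using that mlt_obj by (cases p) simp
  show "case p of (f, gs) \<Rightarrow> amap to_B (amap (mlt K) (f, gs)) =
      amap (mlt (Bclub aop)) (amap to_B f, map (amap to_B) gs)"
    if "p \<in> circ_arr (ucat K) (prj K)" for p
  proof (cases p)
    case (Pair f gs)
    have fgs: "(f, gs) \<in> circ_arr (ucat K) (prj K)"
      using that Pair by simp
    have gs: "map (amap to_B) gs = map (\<lambda>g. (deg g, g)) gs"
      using fgs by (auto simp: subset_iff)
    have "map fst (map (\<lambda>g. (deg g, g)) gs) = map deg gs" "map snd (map (\<lambda>g. (deg g, g)) gs) = gs"
      by (simp_all add: o_def)
    moreover have "((deg f, f), map (\<lambda>g. (deg g, g)) gs) \<in> circ_arr (deloop (grp aop)) (Bprj aop)"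
      using fgs by (auto simp: deg_def subset_iff)
    ultimately have "amap (mlt (Bclub aop)) ((deg f, f), map (\<lambda>g. (deg g, g)) gs) =
        (sum_list (map deg gs), amap (mlt K) (f, gs))"
      using fgs by (simp add: deg_def del: map_map)
    then show ?thesis
      using mlt_arr[OF fgs] fgs by (simp add: Pair gs)
  qed
qed

lemma club_morphism_from_B: "club_morphism (Bclub aop) K from_B"
  unfolding club_morphism_def Bclub_simps
proof (intro conjI ballI)
  show "club K" "club (Bclub aop)"
    by (rule club_axioms, rule aop.club_Bclub)
  show "is_functor (deloop (grp aop)) (ucat K) from_B"
  proof (unfold is_functor_def is_functor_axioms_def, intro conjI allI impI)
    show "amap from_B \<in> Arr (deloop (grp aop)) \<rightarrow>\<^sub>E Arr (ucat K)"
      by (auto simp: from_B_def)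
  qed (auto simp: source.category_axioms aop.category_deloop_grp Hom_def composable_def Dom_eq Cod_eq from_B_def)
  show "comp_funct (deloop (grp aop)) (prj K) from_B = Bprj aop"
    by (auto simp: comp_funct_def Bprj_def from_B_def compose_def fun_eq_iff amap_eq simp flip: deg_def)
  show "omap from_B 1 = unt K"
    using pt_omap[OF unt_obj] prj_unt by simp
  show "case p of (n, ks) \<Rightarrow> omap from_B (omap (mlt (Bclub aop)) (n, ks)) =
      omap (mlt K) (omap from_B n, map (omap from_B) ks)"
    if "p \<in> circ_obj (deloop (grp aop)) (Bprj aop)" for p
  proof (cases p)
    case (Pair n ks)
    \<comment> \<open>Since \<open>m\<close> lies over B\<Sigma>, its value on objects has the sum
      of the arities as arity, and an object of \<open>K\<close> is determined by its arity. So
      \<open>m\<close> must be addition on objects.\<close>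
    have "(pt n, map pt ks) \<in> circ_obj (ucat K) (prj K)"
      using that Pair by auto
    from mlt_obj[OF this] pt_omap[OF mlt_obj(1)[OF this]] that show ?thesis
      by (simp add: Pair o_def)
  qed
  show "case p of (f, gs) \<Rightarrow> amap from_B (amap (mlt (Bclub aop)) (f, gs)) =
      amap (mlt K) (amap from_B f, map (amap from_B) gs)"
    if "p \<in> circ_arr (deloop (grp aop)) (Bprj aop)" for p
  proof (cases p)
    case (Pair q gs)
    have "(q, gs) \<in> circ_arr (deloop (grp aop)) (Bprj aop)"
      using that Pair by simp
    then obtain n f where f: "q = (n, f)" "f \<in> ops aop n" "length gs = n"
      and gs: "map snd gs \<in> listset (map (ops aop) (map fst gs))"
      and op: "opmu aop (map fst gs) (f, map snd gs) \<in> ops aop (sum_list (map fst gs))"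
      "amap (mlt (Bclub aop)) (q, gs) = (sum_list (map fst gs), opmu aop (map fst gs) (f, map snd gs))"
      by (rule aop.Bclub_mlt_arr)
    have "map (amap from_B) gs = map snd gs"
      using that Pair by (auto simp: subset_iff)
    moreover have "opmu aop (map fst gs) (f, map snd gs) = amap (mlt K) (f, map snd gs)"
      using f gs unfolding aop_simps(1) in_listset_deg by simp
    ultimately show ?thesis
      unfolding Pair prod.case op(2) using f op(1) by (simp del: map_eq_conv)
  qed
qed

lemma clubs_isomorphic_aop: "clubs_isomorphic K (Bclub aop)"
proof -
  have "comp_funct (ucat K) from_B to_B = id_funct (ucat K)"
    by (auto simp: comp_funct_def id_funct_def compose_def fun_eq_iff)
  moreover have "comp_funct (deloop (grp aop)) to_B from_B = id_funct (deloop (grp aop))"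
    by (auto simp: comp_funct_def id_funct_def compose_def fun_eq_iff)
  ultimately show ?thesis
    using club_morphism_to_B club_morphism_from_B unfolding clubs_isomorphic_def by auto
qed

end

theorem theorem15p9:
  shows "(\<forall>K :: ('o, 'm) club.
      club K \<longrightarrow>
      bij_betw (omap (prj K)) (Obj (ucat K)) (Obj BSigma) \<longrightarrow>
      groupoid (ucat K) \<longrightarrow>
      (\<exists>\<Lambda> :: 'm action_operad. action_operad \<Lambda> \<and> clubs_isomorphic K (Bclub \<Lambda>))) \<and>
    full_faithful_embedding (AOp :: ('a action_operad, _) cat) Clubs B_functor"
proof (intro conjI allI impI)
  fix K :: "('o, 'm) club"
  assume "club K" "bij_betw (omap (prj K)) (Obj (ucat K)) (Obj BSigma)" "groupoid (ucat K)"
  then interpret groupoid_club K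
    by (simp add: groupoid_club_def groupoid_club_axioms_def)
  show "\<exists>\<Lambda> :: 'm action_operad. action_operad \<Lambda> \<and> clubs_isomorphic K (Bclub \<Lambda>)"
    using action_operad_aop clubs_isomorphic_aop by blast
qed (rule B_functor_full_faithful_embedding)

end
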